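(* Suppose Stag Hunt is played by $2n$ players, each of which is either a stag hunter or a rabbit hunter, with the visiting probabilities and cumulative weight dynamics described in the context, with no noise or discounting. Then in the limit, stag hunters always visit stag hunters and rabbit hunters visit rabbit hunters; that is, almost surely, $p_{ij}(t)\to 0$ as $t\to\infty$ for all players $i\ne j$ of different types.
   Context: Stag Hunt game: a two-player symmetric game in which each player either hunts stag or hunts rabbit. If both hunt stag, each receives payoff $1$. If one hunts stag and the other hunts rabbit, the stag hunter receives $0$ and the rabbit hunter receives $0.75$. If both hunt rabbit, each receives $0.75$. A stag hunter is a player who always hunts stag, a rabbit hunter is a player who always hunts rabbit; types are fixed for all time. Dynamics: at each discrete time $t$ each player $i$ has weights $w_{ij}(t)$ for the players $j$, with $w_{ii}(t)=0$; initially $w_{ij}=1$ for all $i\neq j$. In round $t$, every player $i$ visits exactly one other player; conditionally on the past, the players make their choices independently, and player $i$ visits player $j$ with probability $p_{ij}(t)=w_{ij}(t)/\sum_k w_{ik}(t)$. At each visit the visitor and the host play one Stag Hunt game, and both are reinforced by their own payoffs, with weights accumulating additively: for each visit between $i$ and $j$ in round $t$ (whether $i$ visits $j$ or $j$ visits $i$), the payoff received by $i$ in that game is added to $w_{ij}$ and the payoff received by $j$ is added to $w_{ji}$. The weights resulting after all visits of round $t$ are the weights at time $t+1$. No noise means that visits follow exactly these probabilities; no discounting means that past weights are not multiplied by a factor less than $1$.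
   Formalization: Assumes additionally that neither type consists of exactly one player: a lone rabbit hunter can only visit stag hunters, and a lone stag hunter keeps all weights 1 and visits each rabbit hunter with probability 1/(2n-1) forever, so the claim fails there. *)

theory Defs
  imports "HOL-Probability.Probability"
begin

datatype strategy = Stag | Rabbit

text \<open>The payoff of the first player against the second.\<close>

fun stag_hunt_payoff :: "strategy \<Rightarrow> strategy \<Rightarrow> real" where
  "stag_hunt_payoff Stag Stag = 1"
| "stag_hunt_payoff Stag Rabbit = 0"
| "stag_hunt_payoff Rabbit Stag = 3/4"
| "stag_hunt_payoff Rabbit Rabbit = 3/4"

text \<open>Players are the elements of a finite type, and \<open>\<sigma> i\<close> is the fixed type of player \<open>i\<close>.
  A play \<open>v\<close> records the visits of all rounds: in round \<open>t\<close>, player \<open>i\<close> visits \<open>v t i\<close>.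
  Mutual visits of \<open>i\<close> and \<open>j\<close> in the same round are two visits, hence two games.\<close>

definition num_visits :: "('p \<Rightarrow> 'p) \<Rightarrow> 'p \<Rightarrow> 'p \<Rightarrow> nat" where
  "num_visits c i j = of_bool (c i = j) + of_bool (c j = i)"

primrec weight :: "('p \<Rightarrow> strategy) \<Rightarrow> (nat \<Rightarrow> 'p \<Rightarrow> 'p) \<Rightarrow> nat \<Rightarrow> 'p \<Rightarrow> 'p \<Rightarrow> real" where
  "weight \<sigma> v 0 i j = (if i = j then 0 else 1)"
| "weight \<sigma> v (Suc t) i j =
     (if i = j then 0
      else weight \<sigma> v t i j + real (num_visits (v t) i j) * stag_hunt_payoff (\<sigma> i) (\<sigma> j))"

definition visit_prob ::
    "('p::finite \<Rightarrow> strategy) \<Rightarrow> (nat \<Rightarrow> 'p \<Rightarrow> 'p) \<Rightarrow> nat \<Rightarrow> 'p \<Rightarrow> 'p \<Rightarrow> real" where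
  "visit_prob \<sigma> v t i j = weight \<sigma> v t i j / (\<Sum>k\<in>UNIV. weight \<sigma> v t i k)"

text \<open>The random variable \<open>V t i\<close> is the player visited by \<open>i\<close> in round \<open>t\<close>. Each round has only
  finitely many outcomes, so conditioning on the past before round \<open>t\<close> means conditioning on the
  events that the first \<open>t\<close> rounds agree with a given play \<open>h\<close>. The value \<open>visit_prob \<sigma> h t i j\<close>
  depends only on the rounds of \<open>h\<close> before \<open>t\<close>.\<close>

locale stag_hunt_network = prob_space M
  for M :: "'a measure" +
  fixes \<sigma> :: "'p::finite \<Rightarrow> strategy"
    and V :: "nat \<Rightarrow> 'p \<Rightarrow> 'a \<Rightarrow> 'p"
  assumes visit_measurable: "V t i \<in> measurable M (count_space UNIV)"
    and visit_law:
      "\<P>(\<omega> in M. \<forall>s<t. \<forall>k. V s k \<omega> = h s k) > 0 \<Longrightarrow>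
       \<P>(\<omega> in M. V t i \<omega> = j \<bar> \<forall>s<t. \<forall>k. V s k \<omega> = h s k) = visit_prob \<sigma> h t i j"
    and visit_indep:
      "\<P>(\<omega> in M. \<forall>s<t. \<forall>k. V s k \<omega> = h s k) > 0 \<Longrightarrow>
       \<P>(\<omega> in M. \<forall>i. V t i \<omega> = c i \<bar> \<forall>s<t. \<forall>k. V s k \<omega> = h s k) =
         (\<Prod>i\<in>UNIV. \<P>(\<omega> in M. V t i \<omega> = c i \<bar> \<forall>s<t. \<forall>k. V s k \<omega> = h s k))"

end

theory Submission imports Defs begin

text \<open>
  A stag hunter \<open>i\<close> gives each rabbit hunter the constant weight 1, while its weight for the other
  stag hunters grows linearly: a visit to one of them always has probability at least
  \<open>1 / (1 + CARD('p))\<close>.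

  For a rabbit hunter \<open>i\<close> let \<open>Y\<close> and \<open>X\<close> be its total weights for stag and for rabbit hunters.
  The function \<open>Y / (X - 3/4)\<close> is an exact martingale under the visits of \<open>i\<close> alone. The
  visits of other rabbit hunters to \<open>i\<close> only enlarge \<open>X\<close>, which multiplies the mean by at most
  \<open>1 - e / (t + 1)\<close>, and the visits of stag hunters are so rare that they add at most
  \<open>C / (t + 1) ^ (1 + d)\<close>. Hence the mean decays polynomially; Borel-Cantelli along the times
  \<open>2 ^ k\<close>, together with the monotonicity of \<open>Y\<close> and the linear growth of \<open>X + Y\<close>, gives almost
  sure convergence without any martingale theory.
\<close>

subsection \<open>Auxiliary facts on sums and limits\<close>

lemma sum_prod_fun_UNIV:
  fixes f :: "'p::finite \<Rightarrow> 'q::finite \<Rightarrow> 'r::comm_semiring_1"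
  shows "(\<Sum>c\<in>UNIV. \<Prod>i\<in>UNIV. f i (c i)) = (\<Prod>i\<in>UNIV. \<Sum>j\<in>UNIV. f i j)"
  using prod_sum_PiE[of UNIV "\<lambda>_. UNIV" f] by (simp add: PiE_UNIV_domain)

text \<open>Induction with the bound \<open>K * s powr (- r)\<close>, where
  \<open>s = Suc t\<close>, for an exponent \<open>r\<close> below \<open>e\<close>: passing from
  \<open>s\<close> to \<open>s + 1\<close> costs at most a factor \<open>1 - r / s\<close>, so the
  contraction \<open>1 - e / s\<close> leaves a margin of order \<open>s powr (- 1 - r)\<close> that
  absorbs the source term.\<close>

lemma decay_of_recursion:
  fixes a :: "nat \<Rightarrow> real"
  assumes "0 < e" "e \<le> 1" "0 < d" "0 \<le> C"
    and step: "\<And>t. a (Suc t) \<le> (1 - e / Suc t) * a t + C * real (Suc t) powr (- 1 - d)"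
  shows "\<exists>r K. 0 < r \<and> r \<le> 1 \<and> 0 \<le> K \<and> (\<forall>t. a t \<le> K * real (Suc t) powr (- r))"
proof -
  \<comment> \<open>\<open>r < e\<close> creates the margin \<open>e - r\<close>, and
    \<open>r \<le> d\<close> lets it dominate the source; \<open>K\<close> covers the start and
    satisfies \<open>C \<le> K * (e - r)\<close>.\<close>
  define r where "r = min e d / 2"
  define K where "K = max \<bar>a 0\<bar> (C / (e - r))"
  have r: "0 < r" "r \<le> 1" "r < e" "r \<le> d" using assms by (auto simp: r_def min_def)
  have K: "0 \<le> K" "C \<le> K * (e - r)" "a 0 \<le> K"
    using r pos_divide_le_eq[of "e - r" C K] by (auto simp: K_def)
  have "a t \<le> K * real (Suc t) powr (- r)" for t
  proof (induction t)
    case 0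
    show ?case using K by simp
  next
    case (Suc t)
    define s where "s = real (Suc t)"
    have s: "s \<ge> 1" by (simp add: s_def)
    have bern: "s powr (- r) * (1 - r / s) \<le> (s + 1) powr (- r)"
    proof -
      have "1 - r / s \<le> exp (- r / s)" using exp_ge_add_one_self[of "- r / s"] by simp
      also have "\<dots> \<le> exp (- r * ln (1 + 1 / s))"
        using ln_add_one_self_le_self[of "1 / s"] r s by (simp add: field_simps)
      also have "\<dots> = (1 + 1 / s) powr (- r)" using s by (simp add: powr_def add_nonneg_eq_0_iff)
      finally have "s powr (- r) * (1 - r / s) \<le> s powr (- r) * (1 + 1 / s) powr (- r)"
        by (intro mult_left_mono) auto
      also have "\<dots> = (s * (1 + 1 / s)) powr (- r)" using s by (intro powr_mult [symmetric])
      also have "s * (1 + 1 / s) = s + 1" using s by (simp add: field_simps)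
      finally show ?thesis .
    qed
    have "C * s powr (- 1 - d) \<le> (K * (e - r)) * s powr (- 1 - r)"
      using K r s assms by (intro mult_mono powr_mono) auto
    also have "s powr (- 1 - r) = s powr (- r) / s" using s by (simp add: powr_diff powr_minus field_simps)
    finally have src: "C * s powr (- 1 - d) \<le> K * (e - r) * (s powr (- r) / s)" .
    \<comment> \<open>The contraction factor is nonnegative, so the induction hypothesis may be
      multiplied by it whatever the sign of \<open>a t\<close>.\<close>
    have "e / s \<le> 1" using s assms by simp
    then have "(1 - e / s) * a t \<le> (1 - e / s) * (K * s powr (- r))"
      using Suc.IH by (intro mult_left_mono) (auto simp: s_def)
    then have "a (Suc t) \<le> (1 - e / s) * (K * s powr (- r)) + K * (e - r) * (s powr (- r) / s)"
      using step[of t] src by (simp add: s_def)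
    also have "\<dots> = K * (s powr (- r) * (1 - r / s))"
      by (simp add: algebra_simps diff_divide_distrib)
    also have "\<dots> \<le> K * (s + 1) powr (- r)" using bern K by (intro mult_left_mono) auto
    finally show ?case by (simp add: s_def add.commute)
  qed
  then show ?thesis using r K by blast
qed

text \<open>By monotone convergence the sum of all \<open>f k\<close> has finite mean, so it is
  finite almost everywhere and its terms tend to 0.\<close>

lemma (in prob_space) AE_tendsto_0_of_summable_expectation:
  fixes f :: "nat \<Rightarrow> 'a \<Rightarrow> real"
  assumes int: "\<And>k. integrable M (f k)"
    and nonneg: "\<And>k \<omega>. \<omega> \<in> space M \<Longrightarrow> 0 \<le> f k \<omega>"
    and "\<And>k. expectation (f k) \<le> b k" "summable b"
  shows "AE \<omega> in M. (\<lambda>k. f k \<omega>) \<longlonglongrightarrow> 0"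
proof -
  have exp_nonneg: "0 \<le> expectation (f k)" for k using nonneg by (intro Bochner_Integration.integral_nonneg) auto
  have "summable (\<lambda>k. expectation (f k))"
    using exp_nonneg assms(3) by (intro summable_comparison_test'[OF assms(4)]) auto
  moreover have "(\<integral>\<^sup>+\<omega>. (\<Sum>k. ennreal (f k \<omega>)) \<partial>M) = (\<Sum>k. ennreal (expectation (f k)))"
    using int nonneg by (subst nn_integral_suminf) (auto simp: nn_integral_eq_integral)
  ultimately have "(\<integral>\<^sup>+\<omega>. (\<Sum>k. ennreal (f k \<omega>)) \<partial>M) \<noteq> \<infinity>"
    using exp_nonneg by (simp add: suminf_ennreal2)
  then have "AE \<omega> in M. (\<Sum>k. ennreal (f k \<omega>)) \<noteq> \<infinity>"
    using int by (intro nn_integral_PInf_AE) auto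
  with AE_space show ?thesis
  proof eventually_elim
    case (elim \<omega>)
    then have "summable (\<lambda>k. f k \<omega>)" using nonneg by (intro summable_suminf_not_top) auto
    then show ?case by (rule summable_LIMSEQ_zero)
  qed
qed

subsection \<open>Weights and one-round averages\<close>

definition total_weight :: "('p::finite \<Rightarrow> strategy) \<Rightarrow> (nat \<Rightarrow> 'p \<Rightarrow> 'p) \<Rightarrow> nat \<Rightarrow> 'p \<Rightarrow> real"
  where "total_weight \<sigma> v t i = (\<Sum>k\<in>UNIV. weight \<sigma> v t i k)"

definition type_weight ::
    "('p::finite \<Rightarrow> strategy) \<Rightarrow> (nat \<Rightarrow> 'p \<Rightarrow> 'p) \<Rightarrow> nat \<Rightarrow> 'p \<Rightarrow> strategy \<Rightarrow> real"
  where "type_weight \<sigma> v t i s = (\<Sum>k | \<sigma> k = s \<and> k \<noteq> i. weight \<sigma> v t i k)"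

text \<open>The conditional expectation of \<open>f\<close>, a function of the choices in round
  \<open>t\<close>, given that the earlier rounds follow \<open>h\<close>; independence makes the
  joint law a product.\<close>

definition round_mean ::
    "('p::finite \<Rightarrow> strategy) \<Rightarrow> (nat \<Rightarrow> 'p \<Rightarrow> 'p) \<Rightarrow> nat \<Rightarrow> (('p \<Rightarrow> 'p) \<Rightarrow> real) \<Rightarrow> real"
  where "round_mean \<sigma> h t f = (\<Sum>c\<in>UNIV. (\<Prod>i\<in>UNIV. visit_prob \<sigma> h t i (c i)) * f c)"

text \<open>Stated for plays, this takes the place of measurability with respect to the
  past.\<close>

definition determined_before :: "nat \<Rightarrow> ((nat \<Rightarrow> 'b) \<Rightarrow> 'c) \<Rightarrow> bool"
  where "determined_before t F \<longleftrightarrow> (\<forall>h h'. (\<forall>s<t. h s = h' s) \<longrightarrow> F h = F h')"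

lemma stag_hunt_payoff_bounds: "0 \<le> stag_hunt_payoff a b" "stag_hunt_payoff a b \<le> 1"
  by (cases a; cases b; simp)+

lemma payoff_Rabbit [simp]: "stag_hunt_payoff Rabbit s = 3/4"
  by (cases s) auto

lemma weight_cong: "(\<And>s. s < t \<Longrightarrow> h s = h' s) \<Longrightarrow> weight \<sigma> h t = weight \<sigma> h' t"
proof (induction t)
  case 0
  show ?case by (intro ext) simp
next
  case (Suc t)
  then have "weight \<sigma> h t = weight \<sigma> h' t" "h t = h' t" by auto
  then show ?case by (intro ext) simp
qed

text \<open>The potentials below are functions of the weight table at time \<open>t\<close>, which
  only earlier rounds influence.\<close>

lemma determined_beforeI:
  "(\<And>h h'. weight \<sigma> h t = weight \<sigma> h' t \<Longrightarrow> F h = F h') \<Longrightarrow> determined_before t F"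
  unfolding determined_before_def by (metis weight_cong)

lemma weight_self [simp]: "weight \<sigma> v t i i = 0"
  by (cases t) auto

lemma weight_ge_1: "i \<noteq> j \<Longrightarrow> 1 \<le> weight \<sigma> v t i j"
proof (induction t)
  case (Suc t)
  have "0 \<le> real (num_visits (v t) i j) * stag_hunt_payoff (\<sigma> i) (\<sigma> j)"
    by (simp add: stag_hunt_payoff_bounds)
  with Suc show ?case by simp
qed simp

lemma weight_nonneg: "0 \<le> weight \<sigma> v t i j"
  using weight_ge_1[of i j \<sigma> v t] by (cases "i = j") auto

lemma weight_mono: "t \<le> u \<Longrightarrow> weight \<sigma> v t i j \<le> weight \<sigma> v u i j"
proof (induction u rule: dec_induct)
  case (step u)
  have "0 \<le> real (num_visits (v u) i j) * stag_hunt_payoff (\<sigma> i) (\<sigma> j)"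
    by (simp add: stag_hunt_payoff_bounds)
  with step show ?case by auto
qed simp

lemma type_weight_mono: "t \<le> u \<Longrightarrow> type_weight \<sigma> v t i s \<le> type_weight \<sigma> v u i s"
  unfolding type_weight_def by (intro sum_mono weight_mono)

text \<open>A stag hunter earns 0 against a rabbit hunter, so the initial weight is never
  reinforced.\<close>

lemma weight_Stag_Rabbit:
  "\<sigma> i = Stag \<Longrightarrow> \<sigma> j = Rabbit \<Longrightarrow> weight \<sigma> v t i j = 1"
  by (induction t) auto

text \<open>All players of type \<open>s\<close> yield the same payoff, so only the number of games
  counts: at most one by the own visit, plus the visits received.\<close>

lemma type_weight_Suc:
  "type_weight \<sigma> v (Suc t) i s = type_weight \<sigma> v t i s + stag_hunt_payoff (\<sigma> i) s *
     (of_bool (\<sigma> (v t i) = s \<and> v t i \<noteq> i) + (\<Sum>k | \<sigma> k = s \<and> k \<noteq> i. of_bool (v t k = i)))"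
proof -
  have own: "(\<Sum>k | \<sigma> k = s \<and> k \<noteq> i. of_bool (v t i = k)) = (of_bool (\<sigma> (v t i) = s \<and> v t i \<noteq> i) :: real)"
    by (simp add: of_bool_def sum.If_cases)
  have "type_weight \<sigma> v (Suc t) i s = (\<Sum>k | \<sigma> k = s \<and> k \<noteq> i. weight \<sigma> v t i k +
          stag_hunt_payoff (\<sigma> i) s * (of_bool (v t i = k) + of_bool (v t k = i)))"
    unfolding type_weight_def by (intro sum.cong) (auto simp: num_visits_def)
  also have "\<dots> = type_weight \<sigma> v t i s + stag_hunt_payoff (\<sigma> i) s *
      ((\<Sum>k | \<sigma> k = s \<and> k \<noteq> i. of_bool (v t i = k)) + (\<Sum>k | \<sigma> k = s \<and> k \<noteq> i. of_bool (v t k = i)))"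
    by (simp add: sum.distrib type_weight_def flip: sum_distrib_left)
  finally show ?thesis unfolding own .
qed

lemma total_weight_split:
  "total_weight \<sigma> v t i = type_weight \<sigma> v t i Stag + type_weight \<sigma> v t i Rabbit"
proof -
  have "total_weight \<sigma> v t i = (\<Sum>k\<in>UNIV - {i}. weight \<sigma> v t i k)"
    unfolding total_weight_def by (subst sum.remove[of _ i]) auto
  also have "UNIV - {i} = {k. \<sigma> k = Stag \<and> k \<noteq> i} \<union> {k. \<sigma> k = Rabbit \<and> k \<noteq> i}"
    using strategy.exhaust by auto
  also have "(\<Sum>k\<in>\<dots>. weight \<sigma> v t i k) = type_weight \<sigma> v t i Stag + type_weight \<sigma> v t i Rabbit"
    unfolding type_weight_def by (rule sum.union_disjoint) auto
  finally show ?thesis .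
qed

lemma type_weight_nonneg: "0 \<le> type_weight \<sigma> v t i s"
  unfolding type_weight_def by (intro sum_nonneg weight_nonneg)

lemma type_weight_ge_1:
  assumes "j \<noteq> i" "\<sigma> j = s"
  shows "1 \<le> type_weight \<sigma> v t i s"
proof -
  have "weight \<sigma> v t i j \<le> type_weight \<sigma> v t i s"
    unfolding type_weight_def using assms by (intro member_le_sum weight_nonneg) auto
  then show ?thesis using weight_ge_1[of i j \<sigma> v t] assms by auto
qed

lemma total_weight_ge_1:
  assumes "j \<noteq> i"
  shows "1 \<le> total_weight \<sigma> v t i"
  using type_weight_ge_1[OF assms refl, of \<sigma> v t] type_weight_nonneg[of \<sigma> v t i]
  by (cases "\<sigma> j") (auto simp: total_weight_split add_increasing add_increasing2)

text \<open>A round brings at most one game as visitor and \<open>CARD('p)\<close> games as host,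
  each paying at most 1.\<close>

lemma total_weight_le:
  fixes \<sigma> :: "'p::finite \<Rightarrow> strategy"
  shows "total_weight \<sigma> v t i \<le> (CARD('p) + 1) * real (Suc t)"
proof (induction t)
  case 0
  have "total_weight \<sigma> v 0 i \<le> (\<Sum>k\<in>(UNIV::'p set). 1)" unfolding total_weight_def by (intro sum_mono) auto
  then show ?case by simp
next
  case (Suc t)
  have "total_weight \<sigma> v (Suc t) i \<le>
      (\<Sum>k\<in>UNIV. weight \<sigma> v t i k + (of_bool (v t i = k) + of_bool (v t k = i)))"
    unfolding total_weight_def
  proof (intro sum_mono)
    fix k
    have "real (num_visits (v t) i k) * stag_hunt_payoff (\<sigma> i) (\<sigma> k) \<le> real (num_visits (v t) i k) * 1"
      by (intro mult_left_mono stag_hunt_payoff_bounds) auto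
    then show "weight \<sigma> v (Suc t) i k \<le> weight \<sigma> v t i k + (of_bool (v t i = k) + of_bool (v t k = i))"
      by (auto simp: num_visits_def)
  qed
  also have "\<dots> = total_weight \<sigma> v t i + (1 + (\<Sum>k\<in>UNIV. of_bool (v t k = i)))"
    by (simp add: sum.distrib total_weight_def of_bool_def)
  also have "(\<Sum>k\<in>UNIV. of_bool (v t k = i)) \<le> (\<Sum>k\<in>(UNIV::'p set). 1::real)" by (intro sum_mono) auto
  finally show ?case using Suc by (simp add: algebra_simps)
qed

lemma visit_prob_total: "visit_prob \<sigma> v t i j = weight \<sigma> v t i j / total_weight \<sigma> v t i"
  by (simp add: visit_prob_def total_weight_def)

lemma visit_prob_nonneg: "0 \<le> visit_prob \<sigma> v t i j"
  unfolding visit_prob_def by (intro divide_nonneg_nonneg sum_nonneg weight_nonneg)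

lemma exists_other:
  fixes i :: "'p::finite"
  assumes "CARD('p) \<ge> 2"
  shows "\<exists>j. j \<noteq> i"
proof (rule ccontr)
  assume "\<nexists>j. j \<noteq> i"
  then have "(UNIV :: 'p set) \<subseteq> {i}" by auto
  from card_mono[OF _ this] assms show False by simp
qed

text \<open>A second player makes the total weight positive; with a single player the quotient would
  be 0 by convention.\<close>

lemma sum_visit_prob:
  fixes \<sigma> :: "'p::finite \<Rightarrow> strategy"
  assumes "CARD('p) \<ge> 2"
  shows "(\<Sum>j\<in>UNIV. visit_prob \<sigma> v t i j) = 1"
proof -
  obtain j where "j \<noteq> i" using exists_other[OF assms] by blast
  from total_weight_ge_1[OF this, of \<sigma> v t] show ?thesis
    by (simp add: visit_prob_total total_weight_def flip: sum_divide_distrib)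
qed

lemma sum_visit_prob_type:
  "(\<Sum>j\<in>UNIV. visit_prob \<sigma> v t i j * of_bool (\<sigma> j = s \<and> j \<noteq> i))
    = type_weight \<sigma> v t i s / total_weight \<sigma> v t i"
proof -
  have "(\<Sum>j\<in>UNIV. visit_prob \<sigma> v t i j * of_bool (\<sigma> j = s \<and> j \<noteq> i))
      = (\<Sum>j | \<sigma> j = s \<and> j \<noteq> i. visit_prob \<sigma> v t i j)"
    by (simp add: of_bool_def if_distrib sum.If_cases cong: if_cong)
  then show ?thesis by (simp add: visit_prob_total type_weight_def flip: sum_divide_distrib)
qed

section \<open>Averages over the independent choices of one round\<close>

lemma round_mean_mono: "(\<And>c. f c \<le> g c) \<Longrightarrow> round_mean \<sigma> h t f \<le> round_mean \<sigma> h t g"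
  unfolding round_mean_def by (intro sum_mono mult_left_mono prod_nonneg ballI visit_prob_nonneg)

lemma round_mean_add: "round_mean \<sigma> h t (\<lambda>c. f c + g c) = round_mean \<sigma> h t f + round_mean \<sigma> h t g"
  by (simp add: round_mean_def algebra_simps sum.distrib)

lemma round_mean_cmult: "round_mean \<sigma> h t (\<lambda>c. a * f c) = a * round_mean \<sigma> h t f"
  by (simp add: round_mean_def algebra_simps sum_distrib_left)

lemma round_mean_sum: "round_mean \<sigma> h t (\<lambda>c. \<Sum>a\<in>A. f a c) = (\<Sum>a\<in>A. round_mean \<sigma> h t (f a))"
  unfolding round_mean_def sum_distrib_left by (rule sum.swap)

text \<open>Independence of two players' choices. The indicator of a joint choice is a product of
  one-player factors, so the sum over all joint choices factorizes and the remaining players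
  contribute 1; general \<open>f\<close> follows by linearity.\<close>

lemma round_mean_pair:
  fixes \<sigma> :: "'p::finite \<Rightarrow> strategy"
  assumes "CARD('p) \<ge> 2" "i \<noteq> k"
  shows "round_mean \<sigma> h t (\<lambda>c. f (c i) (c k)) =
    (\<Sum>a\<in>UNIV. \<Sum>b\<in>UNIV. visit_prob \<sigma> h t i a * visit_prob \<sigma> h t k b * f a b)"
proof -
  let ?q = "visit_prob \<sigma> h t"
  have pair: "round_mean \<sigma> h t (\<lambda>c. of_bool (c i = a \<and> c k = b)) = ?q i a * ?q k b" for a b
  proof -
    \<comment> \<open>The factor 1 for all players other than \<open>i\<close> and \<open>k\<close>
      makes the indicator a product over all players.\<close>
    define r where "r l j = (if l = i then of_bool (j = a) else if l = k then of_bool (j = b) else (1::real))" for l j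
    have r: "(\<Prod>l\<in>UNIV. r l (c l)) = of_bool (c i = a \<and> c k = b)" for c
    proof -
      have "(\<Prod>l\<in>UNIV. r l (c l)) = r i (c i) * (r k (c k) * (\<Prod>l\<in>UNIV - {i} - {k}. r l (c l)))"
        using assms by (subst prod.remove[of _ i], simp, simp, subst prod.remove[of _ k]) auto
      also have "(\<Prod>l\<in>UNIV - {i} - {k}. r l (c l)) = 1" by (intro prod.neutral) (auto simp: r_def)
      finally show ?thesis using assms by (simp add: r_def)
    qed
    have "round_mean \<sigma> h t (\<lambda>c. of_bool (c i = a \<and> c k = b)) = (\<Sum>c\<in>UNIV. \<Prod>l\<in>UNIV. ?q l (c l) * r l (c l))"
      unfolding round_mean_def by (simp add: r prod.distrib)
    also have "\<dots> = (\<Prod>l\<in>UNIV. \<Sum>j\<in>UNIV. ?q l j * r l j)"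
      by (rule sum_prod_fun_UNIV)
    also have "\<dots> = (\<Sum>j\<in>UNIV. ?q i j * r i j) * ((\<Sum>j\<in>UNIV. ?q k j * r k j) *
        (\<Prod>l\<in>UNIV - {i} - {k}. \<Sum>j\<in>UNIV. ?q l j * r l j))"
      using assms by (subst prod.remove[of _ i], simp, simp, subst prod.remove[of _ k]) auto
    also have "(\<Prod>l\<in>UNIV - {i} - {k}. \<Sum>j\<in>UNIV. ?q l j * r l j) = 1"
      using assms by (intro prod.neutral) (auto simp: r_def sum_visit_prob)
    also have "(\<Sum>j\<in>UNIV. ?q i j * r i j) = ?q i a"
      by (simp add: r_def)
    also have "(\<Sum>j\<in>UNIV. ?q k j * r k j) = ?q k b"
      using assms by (simp add: r_def)
    finally show ?thesis by simp
  qed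
  have "f (c i) (c k) = (\<Sum>a\<in>UNIV. \<Sum>b\<in>UNIV. f a b * of_bool (c i = a \<and> c k = b))" for c
  proof -
    have "(\<Sum>a\<in>UNIV. \<Sum>b\<in>UNIV. f a b * of_bool (c i = a \<and> c k = b)) =
        (\<Sum>a\<in>UNIV. of_bool (c i = a) * (\<Sum>b\<in>UNIV. of_bool (c k = b) * f a b))"
      unfolding sum_distrib_left by (intro sum.cong) auto
    then show ?thesis by simp
  qed
  then have "round_mean \<sigma> h t (\<lambda>c. f (c i) (c k)) =
      (\<Sum>a\<in>UNIV. \<Sum>b\<in>UNIV. f a b * round_mean \<sigma> h t (\<lambda>c. of_bool (c i = a \<and> c k = b)))"
    by (simp only: round_mean_sum round_mean_cmult)
  then show ?thesis by (simp add: pair mult.commute)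
qed

lemma round_mean_single:
  fixes \<sigma> :: "'p::finite \<Rightarrow> strategy"
  assumes "CARD('p) \<ge> 2"
  shows "round_mean \<sigma> h t (\<lambda>c. f (c i)) = (\<Sum>a\<in>UNIV. visit_prob \<sigma> h t i a * f a)"
proof -
  \<comment> \<open>An auxiliary player whose choice is ignored and sums out to 1.\<close>
  obtain k where "k \<noteq> i" using exists_other[OF assms] by blast
  then have "round_mean \<sigma> h t (\<lambda>c. f (c i)) =
      (\<Sum>a\<in>UNIV. \<Sum>b\<in>UNIV. visit_prob \<sigma> h t i a * visit_prob \<sigma> h t k b * f a)"
    using round_mean_pair[OF assms, of i k \<sigma> h t "\<lambda>a b. f a"] by simp
  also have "\<dots> = (\<Sum>a\<in>UNIV. visit_prob \<sigma> h t i a * f a)"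
    by (simp add: sum_visit_prob[OF assms] flip: sum_distrib_right sum_distrib_left)
  finally show ?thesis .
qed

subsection \<open>Drift inequalities\<close>

text \<open>\<open>h(t := c)\<close> stands for the past \<open>h\<close> continued by the choices
  \<open>c\<close> in round \<open>t\<close>; weights at time \<open>t\<close> do not see them yet,
  those at \<open>Suc t\<close> do.\<close>

lemma weight_fun_upd [simp]: "weight \<sigma> (h(t := c)) t = weight \<sigma> h t"
  by (rule weight_cong) auto

lemma type_weight_fun_upd_Suc:
  "type_weight \<sigma> (h(t := c)) (Suc t) i s = type_weight \<sigma> h t i s + stag_hunt_payoff (\<sigma> i) s *
     (of_bool (\<sigma> (c i) = s \<and> c i \<noteq> i) + (\<Sum>k | \<sigma> k = s \<and> k \<noteq> i. of_bool (c k = i)))"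
  unfolding type_weight_Suc by (simp add: type_weight_def)

text \<open>Every game between two rabbit hunters pays both of them 3/4. So a large weight of
  \<open>i\<close> for \<open>k\<close> also makes visits of \<open>k\<close> to \<open>i\<close>
  likely.\<close>

lemma weight_Rabbit_sym:
  "\<sigma> i = Rabbit \<Longrightarrow> \<sigma> k = Rabbit \<Longrightarrow> weight \<sigma> v t i k = weight \<sigma> v t k i"
  by (induction t) (auto simp: num_visits_def add.commute)

text \<open>The shift by 3/4, one payoff, makes the stag weight times this quantity an exact
  martingale under the own visit: one more game with a rabbit hunter turns
  \<open>1 / (X - 3/4)\<close> into \<open>1 / X\<close>.\<close>

definition rabbit_inv :: "('p::finite \<Rightarrow> strategy) \<Rightarrow> (nat \<Rightarrow> 'p \<Rightarrow> 'p) \<Rightarrow> nat \<Rightarrow> 'p \<Rightarrow> real"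
  where "rabbit_inv \<sigma> v t i = 1 / (type_weight \<sigma> v t i Rabbit - 3/4)"

text \<open>With \<open>n\<close> players and rabbit weight \<open>X\<close> of \<open>i\<close>,
  some rabbit hunter visits \<open>i\<close> with probability at least
  \<open>X / (n * (n + 1) * Suc t)\<close>. The factor 3/4 of a payoff, halved because of
  \<open>X + 3/4 \<le> 2 * X\<close>, gives 3/8.\<close>

definition return_rate :: "'p::finite itself \<Rightarrow> real"
  where "return_rate _ = 3 / (8 * CARD('p) * (CARD('p) + 1))"

lemma return_rate_bounds: "0 < return_rate TYPE('p::finite)" "return_rate TYPE('p) \<le> 1"
proof -
  have "0 < CARD('p)" by simp
  then have "1 \<le> real (CARD('p))" by linarith
  then have "1 * 1 \<le> real (CARD('p)) * (real (CARD('p)) + 1)" by (intro mult_mono) auto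
  then show "0 < return_rate TYPE('p)" "return_rate TYPE('p) \<le> 1"
    by (auto simp: return_rate_def field_simps)
qed

text \<open>Another rabbit hunter keeps the rabbit weight at least 1, so the denominator is at least
  1/4.\<close>

lemma rabbit_inv_bounds:
  assumes "\<sigma> k = Rabbit" "k \<noteq> i"
  shows "0 \<le> rabbit_inv \<sigma> v t i" "rabbit_inv \<sigma> v t i \<le> 4"
  using type_weight_ge_1[of k i \<sigma> Rabbit v t] assms by (auto simp: rabbit_inv_def field_simps)

text \<open>A visitor who comes with probability \<open>q\<close> multiplies the mean of the inverse
  by exactly \<open>1 - 3/4 * q / x\<close>.\<close>

lemma visit_gain:
  fixes x q e :: real
  assumes "1 \<le> x" "e * x \<le> 3/4 * q"
  shows "(1 - q) * (1 / (x - 3/4)) + q * (1 / (x + 3/4 - 3/4)) \<le> (1 - e) * (1 / (x - 3/4))"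
proof -
  have "(1 - q) * (1 / (x - 3/4)) + q * (1 / (x + 3/4 - 3/4)) = (1 - 3/4 * q / x) * (1 / (x - 3/4))"
    using assms(1) by (simp add: divide_simps) (simp add: algebra_simps)
  also have "e \<le> 3/4 * q / x" using assms by (simp add: pos_le_divide_eq)
  then have "(1 - 3/4 * q / x) * (1 / (x - 3/4)) \<le> (1 - e) * (1 / (x - 3/4))"
    using assms(1) by (intro mult_right_mono) auto
  finally show ?thesis .
qed

text \<open>Pigeonhole: some rabbit hunter holds at least the share \<open>1 / CARD('p)\<close> of
  the rabbit weight of \<open>i\<close>. By symmetry that player gives \<open>i\<close> the same
  weight, while its total weight grows at most linearly. The extra 3/4 on the left leaves room for
  the own visit of \<open>i\<close> in the same round.\<close>

lemma exists_heavy_Rabbit: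
  fixes \<sigma> :: "'p::finite \<Rightarrow> strategy"
  assumes "\<sigma> i = Rabbit" "\<sigma> j = Rabbit" "j \<noteq> i"
  shows "\<exists>k. \<sigma> k = Rabbit \<and> k \<noteq> i \<and> return_rate TYPE('p) / Suc t * (type_weight \<sigma> h t i Rabbit + 3/4)
          \<le> 3/4 * visit_prob \<sigma> h t k i"
proof -
  define X where "X = type_weight \<sigma> h t i Rabbit"
  define n where "n = real (CARD('p))"
  let ?R = "{k. \<sigma> k = Rabbit \<and> k \<noteq> i}"
  have X: "1 \<le> X" unfolding X_def using assms by (intro type_weight_ge_1[of j]) auto
  have n: "0 < n" by (simp add: n_def)
  have "\<exists>k\<in>?R. X / n \<le> weight \<sigma> h t i k"
  proof (rule ccontr)
    assume "\<not> ?thesis"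
    then have "X < (\<Sum>k\<in>?R. X / n)"
      unfolding X_def type_weight_def using assms by (intro sum_strict_mono) (auto simp: not_le)
    also have "\<dots> \<le> (\<Sum>k\<in>(UNIV::'p set). X / n)" using X n by (intro sum_mono2) auto
    also have "\<dots> = X" using n by (simp add: n_def)
    finally show False by simp
  qed
  then obtain k where k: "\<sigma> k = Rabbit" "k \<noteq> i" "X / n \<le> weight \<sigma> h t i k" by blast
  have W: "0 < total_weight \<sigma> h t k" "total_weight \<sigma> h t k \<le> (n + 1) * Suc t"
    using total_weight_ge_1[of i k \<sigma> h t] total_weight_le[of \<sigma> h t k] k by (auto simp: n_def algebra_simps)
  have "return_rate TYPE('p) / Suc t * (X + 3/4) \<le> return_rate TYPE('p) / Suc t * (2 * X)"
    using X return_rate_bounds(1)[where 'p='p] by (intro mult_left_mono) auto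
  also have "\<dots> = 3/4 * ((X / n) / ((n + 1) * Suc t))"
  proof -
    define s where "s = real (Suc t)"
    have "s > 0" by (simp add: s_def)
    then have "3 / (8 * n * (n + 1)) / s * (2 * X) = 3/4 * ((X / n) / ((n + 1) * s))"
      using n add_pos_pos[OF n zero_less_one] by (simp add: divide_simps)
    then show ?thesis unfolding return_rate_def n_def s_def
      by (simp only: of_nat_mult of_nat_add of_nat_1 of_nat_numeral)
  qed
  also have "\<dots> \<le> 3/4 * (weight \<sigma> h t i k / total_weight \<sigma> h t k)"
    using W k X n weight_nonneg by (intro mult_left_mono frac_le) auto
  finally show ?thesis
    using k weight_Rabbit_sym[of \<sigma> i k h t] assms(1) by (auto simp: X_def visit_prob_total)
qed

lemma sum_visit_prob_host:
  fixes \<sigma> :: "'p::finite \<Rightarrow> strategy"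
  assumes "CARD('p) \<ge> 2"
  shows "(\<Sum>b\<in>UNIV. visit_prob \<sigma> h t k b * f (of_bool (b = i) :: real)) =
    (1 - visit_prob \<sigma> h t k i) * f 0 + visit_prob \<sigma> h t k i * (f 1 :: real)"
proof -
  have "(\<Sum>b\<in>UNIV. visit_prob \<sigma> h t k b * f (of_bool (b = i))) =
     (\<Sum>b\<in>UNIV. visit_prob \<sigma> h t k b * f 0 + of_bool (b = i) * (visit_prob \<sigma> h t k b * (f 1 - f 0)))"
    by (intro sum.cong) (auto simp: algebra_simps)
  also have "\<dots> = f 0 + visit_prob \<sigma> h t k i * (f 1 - f 0)"
    using sum_visit_prob[OF assms, of \<sigma> h t k] by (simp add: sum.distrib flip: sum_distrib_right)
  finally show ?thesis by (simp add: algebra_simps)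
qed

text \<open>Of the visits received only that of \<open>k\<close> is kept; upper bounds for
  \<open>rabbit_inv\<close> need only lower bounds for the weight.\<close>

lemma type_weight_fun_upd_Suc_ge:
  assumes "\<sigma> k = s" "k \<noteq> i"
  shows "type_weight \<sigma> h t i s + stag_hunt_payoff (\<sigma> i) s *
      (of_bool (\<sigma> (c i) = s \<and> c i \<noteq> i) + of_bool (c k = i)) \<le> type_weight \<sigma> (h(t := c)) (Suc t) i s"
proof -
  have "of_bool (c k = i) \<le> (\<Sum>k | \<sigma> k = s \<and> k \<noteq> i. of_bool (c k = i) :: real)"
    using assms by (intro member_le_sum) auto
  then show ?thesis unfolding type_weight_fun_upd_Suc
    by (intro add_left_mono mult_left_mono stag_hunt_payoff_bounds)
qed

text \<open>Of all that happens in a round only the visit of the heavy rabbit hunter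
  \<open>k\<close> is counted, and \<open>visit_gain\<close> yields the factor.\<close>

lemma rabbit_inv_drift:
  fixes \<sigma> :: "'p::finite \<Rightarrow> strategy"
  assumes card: "CARD('p) \<ge> 2" and ij: "\<sigma> i = Rabbit" "\<sigma> j = Rabbit" "j \<noteq> i"
  shows "round_mean \<sigma> h t (\<lambda>c. rabbit_inv \<sigma> (h(t := c)) (Suc t) i)
     \<le> (1 - return_rate TYPE('p) / Suc t) * rabbit_inv \<sigma> h t i"
proof -
  let ?X = "type_weight \<sigma> h t i Rabbit"
  let ?e = "return_rate TYPE('p) / Suc t"
  obtain k where k: "\<sigma> k = Rabbit" "k \<noteq> i" "?e * (?X + 3/4) \<le> 3/4 * visit_prob \<sigma> h t k i"
    using exists_heavy_Rabbit[OF ij] by blast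
  have X: "1 \<le> ?X" using ij by (intro type_weight_ge_1[of j]) auto
  have "round_mean \<sigma> h t (\<lambda>c. rabbit_inv \<sigma> (h(t := c)) (Suc t) i)
      \<le> round_mean \<sigma> h t (\<lambda>c. 1 / (?X + 3/4 * of_bool (c k = i) - 3/4))"
  proof (intro round_mean_mono)
    fix c
    have "3/4 * of_bool (c k = i) + ?X \<le> type_weight \<sigma> (h(t := c)) (Suc t) i Rabbit"
      using type_weight_fun_upd_Suc_ge[of \<sigma> k Rabbit i h t c] k ij
      by (simp add: algebra_simps of_bool_def split: if_splits)
    then show "rabbit_inv \<sigma> (h(t := c)) (Suc t) i \<le> 1 / (?X + 3/4 * of_bool (c k = i) - 3/4)"
      unfolding rabbit_inv_def using X by (intro divide_left_mono) auto
  qed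
  also have "\<dots> = (1 - visit_prob \<sigma> h t k i) * (1 / (?X - 3/4)) +
      visit_prob \<sigma> h t k i * (1 / (?X + 3/4 - 3/4))"
    using round_mean_single[OF card, of \<sigma> h t "\<lambda>a. 1 / (?X + 3/4 * of_bool (a = i) - 3/4)" k]
      sum_visit_prob_host[OF card, of \<sigma> h t k "\<lambda>r. 1 / (?X + 3/4 * r - 3/4)" i] by simp
  also have "\<dots> \<le> (1 - ?e) * (1 / (?X - 3/4))"
  proof (rule visit_gain[OF X])
    have "?e * ?X \<le> ?e * (?X + 3/4)"
      using return_rate_bounds(1)[where 'p='p] by (intro mult_left_mono) auto
    with k show "?e * ?X \<le> 3/4 * visit_prob \<sigma> h t k i" by linarith
  qed
  finally show ?thesis by (simp add: rabbit_inv_def)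
qed

text \<open>The visits received from stag hunters are split off and form the last sum. In the rest,
  averaging over the choice of the heavy rabbit hunter \<open>k\<close> gives the factor
  \<open>1 - e\<close> whatever \<open>i\<close> chooses, and averaging over the choice of
  \<open>i\<close> then changes nothing.\<close>

lemma stag_ratio_drift:
  fixes \<sigma> :: "'p::finite \<Rightarrow> strategy"
  assumes card: "CARD('p) \<ge> 2" and ij: "\<sigma> i = Rabbit" "\<sigma> j = Rabbit" "j \<noteq> i"
  shows "round_mean \<sigma> h t (\<lambda>c. type_weight \<sigma> (h(t := c)) (Suc t) i Stag * rabbit_inv \<sigma> (h(t := c)) (Suc t) i)
     \<le> (1 - return_rate TYPE('p) / Suc t) * (type_weight \<sigma> h t i Stag * rabbit_inv \<sigma> h t i)
       + 3/4 * (\<Sum>l | \<sigma> l = Stag. rabbit_inv \<sigma> h t i / total_weight \<sigma> h t l)"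
proof -
  let ?q = "visit_prob \<sigma> h t"
  define X where "X = type_weight \<sigma> h t i Rabbit"
  define Y where "Y = type_weight \<sigma> h t i Stag"
  define W where "W = total_weight \<sigma> h t i"
  define e where "e = return_rate TYPE('p) / Suc t"
  define A where "A = (\<lambda>s a. of_bool (\<sigma> a = s \<and> a \<noteq> i) :: real)"
  define g where "g = (\<lambda>x::real. 1 / (x - 3/4))"
  obtain k where k: "\<sigma> k = Rabbit" "k \<noteq> i" "e * (X + 3/4) \<le> 3/4 * ?q k i"
    unfolding X_def e_def using exists_heavy_Rabbit[OF ij] by blast
  have X: "1 \<le> X" unfolding X_def using ij by (intro type_weight_ge_1[of j]) auto
  have Y: "0 \<le> Y" unfolding Y_def by (rule type_weight_nonneg)
  have e: "0 \<le> e" unfolding e_def using return_rate_bounds(1)[where 'p='p] by simp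
  have A: "0 \<le> A s a" "A s a \<le> 1" for s a by (auto simp: A_def)
  have g_nonneg: "0 \<le> g x" if "1 \<le> x" for x using that by (simp add: g_def)
  have g_mono: "g y \<le> g x" if "1 \<le> x" "x \<le> y" for x y
    using that by (auto simp: g_def intro!: divide_left_mono)
  \<comment> \<open>The ratio after two visits alone, \<open>i\<close> choosing \<open>a\<close> and
    \<open>k\<close> choosing \<open>b\<close>.\<close>
  let ?f = "\<lambda>a b. (Y + 3/4 * A Stag a) * g (X + 3/4 * A Rabbit a + 3/4 * of_bool (b = i))"
  let ?S = "{l. \<sigma> l = Stag}"
  have S: "{l. \<sigma> l = Stag \<and> l \<noteq> i} = ?S" using ij by auto
  have "type_weight \<sigma> (h(t := c)) (Suc t) i Stag * rabbit_inv \<sigma> (h(t := c)) (Suc t) i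
      \<le> ?f (c i) (c k) + (\<Sum>l\<in>?S. 3/4 * g X * of_bool (c l = i))" for c
  proof -
    define X' where "X' = type_weight \<sigma> (h(t := c)) (Suc t) i Rabbit"
    have Y': "type_weight \<sigma> (h(t := c)) (Suc t) i Stag
        = Y + 3/4 * A Stag (c i) + 3/4 * (\<Sum>l\<in>?S. of_bool (c l = i))"
      using ij unfolding type_weight_fun_upd_Suc S by (simp add: Y_def A_def algebra_simps)
    have X': "X + 3/4 * A Rabbit (c i) + 3/4 * of_bool (c k = i) \<le> X'"
      using type_weight_fun_upd_Suc_ge[of \<sigma> k Rabbit i h t c] k ij
      by (simp add: X_def X'_def A_def algebra_simps)
    have bounds: "1 \<le> X + 3/4 * A Rabbit (c i) + 3/4 * of_bool (c k = i)" "X \<le> X'"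
      using X X' A(1)[of Rabbit "c i"] by (auto simp: of_bool_def split: if_splits)
    have "(Y + 3/4 * A Stag (c i)) * g X' \<le> ?f (c i) (c k)"
      using Y A(1)[of Stag "c i"] bounds X' by (intro mult_left_mono g_mono) auto
    \<comment> \<open>For the visits of stag hunters the denominator of the previous round suffices;
      the growth of the rabbit weight is given away.\<close>
    moreover have "3/4 * (\<Sum>l\<in>?S. of_bool (c l = i)) * g X' \<le> 3/4 * (\<Sum>l\<in>?S. of_bool (c l = i)) * g X"
      using X bounds by (intro mult_left_mono g_mono) (auto intro: sum_nonneg)
    moreover have "3/4 * (\<Sum>l\<in>?S. of_bool (c l = i)) * g X = (\<Sum>l\<in>?S. 3/4 * g X * of_bool (c l = i))"
      unfolding sum_distrib_left sum_distrib_right by (intro sum.cong refl) simp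
    moreover have "rabbit_inv \<sigma> (h(t := c)) (Suc t) i = g X'" by (simp add: rabbit_inv_def g_def X'_def)
    ultimately show ?thesis unfolding Y' by (metis (no_types, lifting) add_mono distrib_right)
  qed
  then have "round_mean \<sigma> h t (\<lambda>c. type_weight \<sigma> (h(t := c)) (Suc t) i Stag * rabbit_inv \<sigma> (h(t := c)) (Suc t) i)
      \<le> round_mean \<sigma> h t (\<lambda>c. ?f (c i) (c k)) + (\<Sum>l\<in>?S. 3/4 * g X * round_mean \<sigma> h t (\<lambda>c. of_bool (c l = i)))"
    (is "_ \<le> ?own + ?host")
    unfolding round_mean_add [symmetric] round_mean_cmult [symmetric] round_mean_sum [symmetric]
    by (rule round_mean_mono)
  also have "?host = (\<Sum>l\<in>?S. 3/4 * (rabbit_inv \<sigma> h t i / total_weight \<sigma> h t l))"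
  proof (intro sum.cong refl)
    fix l assume l: "l \<in> ?S"
    have "round_mean \<sigma> h t (\<lambda>c. of_bool (c l = i)) = ?q l i"
      using round_mean_single[OF card, of \<sigma> h t "\<lambda>a. of_bool (a = i)" l] by simp
    \<comment> \<open>The weight of a stag hunter for \<open>i\<close> is always 1.\<close>
    also have "?q l i = 1 / total_weight \<sigma> h t l"
      using l ij by (simp add: visit_prob_total weight_Stag_Rabbit)
    finally show "3/4 * g X * round_mean \<sigma> h t (\<lambda>c. of_bool (c l = i))
        = 3/4 * (rabbit_inv \<sigma> h t i / total_weight \<sigma> h t l)"
      by (simp add: g_def X_def rabbit_inv_def)
  qed
  also have "?own \<le> (1 - e) * (Y * g X)"
  proof -
    have "?own = (\<Sum>a\<in>UNIV. ?q i a * ((Y + 3/4 * A Stag a) *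
        (\<Sum>b\<in>UNIV. ?q k b * g (X + 3/4 * A Rabbit a + 3/4 * of_bool (b = i)))))"
      using k by (subst round_mean_pair[OF card]) (auto simp: sum_distrib_left mult_ac intro!: sum.cong)
    \<comment> \<open>The own visit raises the rabbit weight to at most \<open>X + 3/4\<close>,
      which the choice of \<open>k\<close> allows for, so the factor \<open>1 - e\<close> is
      available for every \<open>a\<close>.\<close>
    also have "\<dots> \<le> (\<Sum>a\<in>UNIV. ?q i a * ((Y + 3/4 * A Stag a) * ((1 - e) * g (X + 3/4 * A Rabbit a))))"
    proof (intro sum_mono mult_left_mono)
      fix a
      let ?x = "X + 3/4 * A Rabbit a"
      have "(\<Sum>b\<in>UNIV. ?q k b * g (?x + 3/4 * of_bool (b = i))) = (1 - ?q k i) * g ?x + ?q k i * g (?x + 3/4)"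
        using sum_visit_prob_host[OF card, of \<sigma> h t k "\<lambda>r. g (?x + 3/4 * r)" i] by simp
      also have "\<dots> \<le> (1 - e) * g ?x"
        unfolding g_def
      proof (rule visit_gain)
        show "1 \<le> ?x" using X A(1)[of Rabbit a] by auto
        have "e * ?x \<le> e * (X + 3/4)" using e A(2)[of Rabbit a] by (intro mult_left_mono) auto
        with k show "e * ?x \<le> 3/4 * ?q k i" by linarith
      qed
      finally show "(\<Sum>b\<in>UNIV. ?q k b * g (?x + 3/4 * of_bool (b = i))) \<le> (1 - e) * g ?x" .
    qed (use Y A in \<open>auto simp: visit_prob_nonneg\<close>)
    \<comment> \<open>\<open>A Stag a\<close> and \<open>A Rabbit a\<close> are never both 1, so the
      product is linear in these indicators.\<close>
    also have "\<dots> = (1 - e) * (\<Sum>a\<in>UNIV. ?q i a * (Y * g X) + (?q i a * A Stag a) * (3/4 * g X)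
        + (?q i a * A Rabbit a) * (Y * (g (X + 3/4) - g X)))"
      unfolding sum_distrib_left by (intro sum.cong refl) (auto simp: A_def field_simps)
    also have "\<dots> = (1 - e) * (Y * g X + Y / W * (3/4 * g X) + X / W * (Y * (g (X + 3/4) - g X)))"
      unfolding sum.distrib sum_distrib_right [symmetric] A_def sum_visit_prob_type
      by (simp add: sum_visit_prob[OF card] X_def Y_def W_def)
    also have "\<dots> = (1 - e) * (Y * g X)"
    proof -
      \<comment> \<open>The player's own visit leaves the mean unchanged, as in Polya's urn.\<close>
      have D: "X * (g (X + 3/4) - g X) = - (3/4 * g X)"
        using X by (simp add: g_def divide_simps)
      have "X / W * (Y * (g (X + 3/4) - g X)) = Y / W * (X * (g (X + 3/4) - g X))" by simp
      also have "\<dots> = - (Y / W * (3/4 * g X))" unfolding D by (rule mult_minus_right)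
      finally show ?thesis by (simp only: add.right_inverse add_0_right add.assoc)
    qed
    finally show ?thesis .
  qed
  finally show ?thesis
    unfolding e_def Y_def g_def X_def rabbit_inv_def sum_distrib_left by (simp only: mult.assoc)
qed

text \<open>The rabbit weight of a stag hunter is at most \<open>CARD('p)\<close> and its stag
  weight at least 1, so each round brings a gain of 1 with probability bounded below, and such a
  gain multiplies the exponential by \<open>exp (- 1)\<close>.\<close>

lemma stag_total_weight_drift:
  fixes \<sigma> :: "'p::finite \<Rightarrow> strategy"
  assumes card: "CARD('p) \<ge> 2" and ij: "\<sigma> i = Stag" "\<sigma> j = Stag" "j \<noteq> i"
  shows "round_mean \<sigma> h t (\<lambda>c. exp (- total_weight \<sigma> (h(t := c)) (Suc t) i))
     \<le> (1 - (1 - exp (- 1)) / (1 + CARD('p))) * exp (- total_weight \<sigma> h t i)"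
proof -
  let ?W = "total_weight \<sigma> h t i"
  let ?S = "type_weight \<sigma> h t i Stag"
  let ?R = "type_weight \<sigma> h t i Rabbit"
  let ?A = "\<lambda>a. of_bool (\<sigma> a = Stag \<and> a \<noteq> i) :: real"
  let ?n = "real (CARD('p))"
  have S: "1 \<le> ?S" using ij by (intro type_weight_ge_1[of j]) auto
  have "?R = (\<Sum>k | \<sigma> k = Rabbit \<and> k \<noteq> i. 1)"
    unfolding type_weight_def using ij by (intro sum.cong) (auto simp: weight_Stag_Rabbit)
  also have "\<dots> \<le> (\<Sum>k\<in>(UNIV::'p set). 1)" by (intro sum_mono2) auto
  finally have R: "?R \<le> ?n" by simp
  have W: "?W = ?S + ?R" by (rule total_weight_split)
  have "1 * ?R \<le> ?S * ?n" using S R type_weight_nonneg[of \<sigma> h t i Rabbit] by (intro mult_mono) auto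
  then have prob_Stag: "1 / (1 + ?n) \<le> ?S / ?W"
    unfolding W using S type_weight_nonneg[of \<sigma> h t i Rabbit]
    by (subst pos_divide_le_eq) (auto simp: pos_le_divide_eq algebra_simps)
  have "round_mean \<sigma> h t (\<lambda>c. exp (- total_weight \<sigma> (h(t := c)) (Suc t) i))
      \<le> round_mean \<sigma> h t (\<lambda>c. exp (- ?W) * (1 - (1 - exp (- 1)) * ?A (c i)))"
  proof (intro round_mean_mono)
    fix c
    have "?W + ?A (c i) \<le> total_weight \<sigma> (h(t := c)) (Suc t) i"
      unfolding total_weight_split type_weight_fun_upd_Suc using ij by (auto intro: sum_nonneg)
    then have "exp (- total_weight \<sigma> (h(t := c)) (Suc t) i) \<le> exp (- ?W - ?A (c i))" by simp
    \<comment> \<open>\<open>exp (- a) = 1 - (1 - exp (- 1)) * a\<close> for \<open>a\<close> equal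
      to 0 or 1.\<close>
    also have "\<dots> = exp (- ?W) * (1 - (1 - exp (- 1)) * ?A (c i))" by (simp add: exp_add [symmetric])
    finally show "exp (- total_weight \<sigma> (h(t := c)) (Suc t) i) \<le> exp (- ?W) * (1 - (1 - exp (- 1)) * ?A (c i))" .
  qed
  also have "\<dots> = exp (- ?W) * (\<Sum>a\<in>UNIV. visit_prob \<sigma> h t i a * (1 - (1 - exp (- 1)) * ?A a))"
    using round_mean_single[OF card, of \<sigma> h t "\<lambda>a. 1 - (1 - exp (- 1)) * ?A a" i]
    by (simp add: round_mean_cmult)
  also have "(\<Sum>a\<in>UNIV. visit_prob \<sigma> h t i a * (1 - (1 - exp (- 1)) * ?A a)) =
      (\<Sum>a\<in>UNIV. visit_prob \<sigma> h t i a) - (1 - exp (- 1)) * (\<Sum>a\<in>UNIV. visit_prob \<sigma> h t i a * ?A a)"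
    by (simp only: sum_distrib_left sum_subtractf [symmetric]) (simp only: algebra_simps mult_1)
  also have "\<dots> = 1 - (1 - exp (- 1)) * (?S / ?W)"
    by (simp only: sum_visit_prob[OF card] sum_visit_prob_type)
  also have "exp (- ?W) * \<dots> \<le> exp (- ?W) * (1 - (1 - exp (- 1)) * (1 / (1 + ?n)))"
    using prob_Stag by (intro mult_left_mono diff_left_mono) auto
  also have "\<dots> = (1 - (1 - exp (- 1)) / (1 + ?n)) * exp (- ?W)" by (simp add: mult.commute)
  finally show ?thesis by (simp only: of_nat_add of_nat_1)
qed

section \<open>From the potentials to visit probabilities along a fixed play\<close>

lemma total_weight_Rabbit_ge:
  assumes "\<sigma> i = Rabbit" "\<And>t. v t i \<noteq> i"
  shows "3/4 * real t \<le> total_weight \<sigma> v t i"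
proof (induction t)
  case 0
  show ?case by (simp add: total_weight_split add_nonneg_nonneg type_weight_nonneg)
next
  case (Suc t)
  let ?B = "\<lambda>s. \<Sum>k | \<sigma> k = s \<and> k \<noteq> i. of_bool (v t k = i) :: real"
  \<comment> \<open>The own visit earns 3/4 from a host of either type; only a self-visit would earn
    nothing.\<close>
  have "total_weight \<sigma> v (Suc t) i = total_weight \<sigma> v t i + 3/4 * (1 + ?B Stag + ?B Rabbit)"
    unfolding total_weight_split type_weight_Suc using assms
    by (cases "\<sigma> (v t i)") (auto simp: field_simps)
  moreover have "0 \<le> ?B s" for s by (intro sum_nonneg) auto
  then have "0 \<le> ?B Stag" "0 \<le> ?B Rabbit" by blast+
  ultimately show ?case using Suc by (simp add: algebra_simps)
qed

text \<open>Comparison with a later time \<open>m\<close> at most twice as large: the stag weight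
  only grows, the rabbit weight at \<open>m\<close> is at most linear in \<open>t\<close>, and the
  total weight at \<open>t\<close> is at least \<open>3/4 * t\<close>. The constant 4 is 3 divided
  by 3/4.\<close>

lemma visit_prob_Rabbit_le:
  fixes \<sigma> :: "'p::finite \<Rightarrow> strategy"
  assumes i: "\<sigma> i = Rabbit" and l: "\<sigma> l = Rabbit" "l \<noteq> i" and j: "\<sigma> j = Stag"
    and no_self: "\<And>t. v t i \<noteq> i" and t: "1 \<le> t" "t \<le> m" "m \<le> 2 * t"
  shows "visit_prob \<sigma> v t i j \<le> 4 * (CARD('p) + 1) * (type_weight \<sigma> v m i Stag * rabbit_inv \<sigma> v m i)"
proof -
  let ?n = "real (CARD('p)) + 1"
  let ?H = "type_weight \<sigma> v m i Stag * rabbit_inv \<sigma> v m i"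
  let ?X = "type_weight \<sigma> v m i Rabbit"
  have X: "1 \<le> ?X" using l by (intro type_weight_ge_1[of l]) auto
  have H: "0 \<le> ?H" using l by (intro mult_nonneg_nonneg type_weight_nonneg rabbit_inv_bounds(1)[of \<sigma> l])
  have "?X \<le> total_weight \<sigma> v m i"
    unfolding total_weight_split using type_weight_nonneg[of \<sigma> v m i Stag] by linarith
  also have "\<dots> \<le> ?n * Suc m" using total_weight_le[of \<sigma> v m i] by (simp add: algebra_simps)
  \<comment> \<open>\<open>Suc m \<le> 2 * t + 1 \<le> 3 * t\<close>.\<close>
  also have "\<dots> \<le> ?n * (3 * t)" using t by (intro mult_left_mono) auto
  finally have Xm: "?X - 3/4 \<le> ?n * (3 * t)" by linarith
  have "weight \<sigma> v t i j \<le> type_weight \<sigma> v t i Stag"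
    unfolding type_weight_def using i j by (intro member_le_sum weight_nonneg) auto
  also have "\<dots> \<le> type_weight \<sigma> v m i Stag" using t by (intro type_weight_mono)
  also have "\<dots> = ?H * (?X - 3/4)" using X by (simp add: rabbit_inv_def)
  also have "\<dots> \<le> ?H * (?n * (3 * t))" by (intro mult_left_mono Xm H)
  finally have "weight \<sigma> v t i j \<le> ?H * (?n * (3 * t))" .
  then have "visit_prob \<sigma> v t i j \<le> ?H * (?n * (3 * t)) / (3/4 * t)"
    unfolding visit_prob_total using t H total_weight_Rabbit_ge[of \<sigma> i v t] i no_self
    by (intro frac_le) auto
  also have "\<dots> = 4 * ?n * ?H" using t by (simp add: field_simps)
  finally show ?thesis by (simp add: algebra_simps)
qed

text \<open>Each \<open>t \<ge> 1\<close> satisfies \<open>2 ^ k \<le> t < 2 ^ (k + 1)\<close> for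
  some \<open>k\<close>, and \<open>2 ^ (k + 1)\<close> serves as the comparison time; so control at
  the powers of 2 suffices.\<close>

lemma visit_prob_Rabbit_tendsto_0:
  fixes \<sigma> :: "'p::finite \<Rightarrow> strategy"
  assumes i: "\<sigma> i = Rabbit" and l: "\<sigma> l = Rabbit" "l \<noteq> i" and j: "\<sigma> j = Stag"
    and no_self: "\<And>t. v t i \<noteq> i"
    and lim: "(\<lambda>k. type_weight \<sigma> v (2 ^ k) i Stag * rabbit_inv \<sigma> v (2 ^ k) i) \<longlonglongrightarrow> 0"
  shows "(\<lambda>t. visit_prob \<sigma> v t i j) \<longlonglongrightarrow> 0"
proof (rule LIMSEQ_I)
  fix r :: real assume "0 < r"
  let ?H = "\<lambda>k. type_weight \<sigma> v (2 ^ k) i Stag * rabbit_inv \<sigma> v (2 ^ k) i"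
  let ?n = "4 * (real (CARD('p)) + 1)"
  have n: "0 < ?n" by simp
  then have "0 < r / ?n" using \<open>0 < r\<close> by simp
  from LIMSEQ_D[OF lim this] obtain k0 where k0: "\<And>k. k0 \<le> k \<Longrightarrow> \<bar>?H k\<bar> < r / ?n" by auto
  show "\<exists>t0. \<forall>t\<ge>t0. norm (visit_prob \<sigma> v t i j - 0) < r"
  proof (intro exI allI impI)
    fix t :: nat assume t: "2 ^ k0 \<le> t"
    have "(1::nat) \<le> 2 ^ k0" by simp
    with t have "1 \<le> t" by linarith
    from ex_power_ivl1[OF order.refl this] obtain k where k: "2 ^ k \<le> t" "t < 2 ^ (k + 1)" by blast
    have "(2::nat) ^ k0 < 2 ^ (k + 1)" using t k by linarith
    then have "k0 < k + 1" by (rule power_less_imp_less_exp[rotated]) simp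
    then have "?H (k + 1) < r / ?n" using k0[of "k + 1"] by simp
    have "visit_prob \<sigma> v t i j \<le> ?n * ?H (k + 1)"
      using visit_prob_Rabbit_le[where \<sigma>=\<sigma> and v=v, OF i l j no_self \<open>1 \<le> t\<close>, of "2 ^ (k + 1)"] k by (simp add: algebra_simps)
    also have "\<dots> < ?n * (r / ?n)" using n \<open>?H (k + 1) < r / ?n\<close> by (rule mult_strict_left_mono[rotated])
    also have "\<dots> = r" using n by (intro nonzero_mult_div_cancel_left[THEN trans[OF times_divide_eq_right]]) linarith
    finally show "norm (visit_prob \<sigma> v t i j - 0) < r" using visit_prob_nonneg[of \<sigma> v t i j] by simp
  qed
qed

text \<open>The probability is the reciprocal of the total weight, which tends to infinity when the
  exponential vanishes.\<close>

lemma visit_prob_Stag_tendsto_0: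
  assumes "\<sigma> i = Stag" "\<sigma> j = Rabbit" and lim: "(\<lambda>t. exp (- total_weight \<sigma> v t i)) \<longlonglongrightarrow> 0"
  shows "(\<lambda>t. visit_prob \<sigma> v t i j) \<longlonglongrightarrow> 0"
proof -
  have "eventually (\<lambda>t. Z < total_weight \<sigma> v t i) sequentially" for Z
    using order_tendstoD(2)[OF lim, of "exp (- Z)"] by simp
  then have "filterlim (\<lambda>t. total_weight \<sigma> v t i) at_top sequentially"
    by (simp add: filterlim_at_top_dense)
  then have "(\<lambda>t. inverse (total_weight \<sigma> v t i)) \<longlonglongrightarrow> 0"
    by (rule tendsto_inverse_0_at_top)
  then show ?thesis using assms by (simp add: visit_prob_total weight_Stag_Rabbit inverse_eq_divide)
qed

subsection \<open>Expectations over finite histories\<close>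

context stag_hunt_network
begin

abbreviation play :: "'a \<Rightarrow> nat \<Rightarrow> 'p \<Rightarrow> 'p"
  where "play \<omega> \<equiv> (\<lambda>s k. V s k \<omega>)"

text \<open>Extensional functions are \<open>undefined\<close> from time \<open>t\<close> on, so
  there are finitely many and each past of length \<open>t\<close> occurs once.\<close>

abbreviation histories :: "nat \<Rightarrow> (nat \<Rightarrow> 'p \<Rightarrow> 'p) set"
  where "histories t \<equiv> {..<t} \<rightarrow>\<^sub>E UNIV"

abbreviation cylinder :: "nat \<Rightarrow> (nat \<Rightarrow> 'p \<Rightarrow> 'p) \<Rightarrow> 'a set"
  where "cylinder t h \<equiv> {\<omega> \<in> space M. \<forall>s<t. \<forall>k. V s k \<omega> = h s k}"

lemma finite_histories: "finite (histories t)"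
  by (intro finite_PiE) auto

lemma visit_event [measurable]: "{\<omega> \<in> space M. V t i \<omega> = j} \<in> events"
proof -
  have "V t i -` {j} \<inter> space M \<in> events" by (rule measurable_sets[OF visit_measurable]) simp
  also have "V t i -` {j} \<inter> space M = {\<omega> \<in> space M. V t i \<omega> = j}" by auto
  finally show ?thesis .
qed

lemma cylinder_event [measurable]: "cylinder t h \<in> events"
  by (intro sets.sets_Collect visit_event)

lemma choice_event [measurable]: "{\<omega> \<in> space M. \<forall>i. V t i \<omega> = c i} \<in> events"
  by (intro sets.sets_Collect visit_event)

text \<open>The cylinders of the finitely many histories partition the space, so a quantity
  determined by the past is a simple function; integrability and expectation reduce to finite
  sums.\<close>

lemma sum_cylinder_indicator:
  assumes "determined_before t F" "\<omega> \<in> space M"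
  shows "(\<Sum>h\<in>histories t. F h * indicator (cylinder t h) \<omega>) = (F (play \<omega>) :: real)"
proof -
  let ?r = "restrict (play \<omega>) {..<t}"
  have "\<omega> \<in> cylinder t h \<longleftrightarrow> h = ?r" if "h \<in> histories t" for h
  proof -
    have "\<omega> \<in> cylinder t h \<longleftrightarrow> (\<forall>s<t. play \<omega> s = h s)" using assms(2) by (auto simp: fun_eq_iff)
    also have "\<dots> \<longleftrightarrow> h = ?r" using that by (auto simp: fun_eq_iff PiE_def extensional_def)
    finally show ?thesis .
  qed
  then have "(\<Sum>h\<in>histories t. F h * indicator (cylinder t h) \<omega>) = (\<Sum>h\<in>histories t. if h = ?r then F h else 0)"
    by (intro sum.cong) (auto simp: indicator_def)
  also have "\<dots> = F ?r" by (simp add: finite_histories)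
  also have "\<dots> = F (play \<omega>)" using assms(1) unfolding determined_before_def by (metis lessThan_iff restrict_apply)
  finally show ?thesis .
qed

lemma integrable_history:
  assumes "determined_before t F"
  shows "integrable M (\<lambda>\<omega>. F (play \<omega>) :: real)"
proof -
  have "integrable M (\<lambda>\<omega>. \<Sum>h\<in>histories t. F h * indicator (cylinder t h) \<omega>)"
    by (intro Bochner_Integration.integrable_sum integrable_mult_right integrable_real_indicator cylinder_event)
      (auto simp: emeasure_eq_measure)
  also have "?this \<longleftrightarrow> ?thesis"
    by (intro Bochner_Integration.integrable_cong refl sum_cylinder_indicator assms)
  finally show ?thesis .
qed

lemma expectation_history:
  assumes "determined_before t F"
  shows "expectation (\<lambda>\<omega>. F (play \<omega>)) = (\<Sum>h\<in>histories t. F h * prob (cylinder t h))"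
proof -
  have "expectation (\<lambda>\<omega>. F (play \<omega>)) = expectation (\<lambda>\<omega>. \<Sum>h\<in>histories t. F h * indicator (cylinder t h) \<omega>)"
    using sum_cylinder_indicator[OF assms] by (intro Bochner_Integration.integral_cong) auto
  also have "\<dots> = (\<Sum>h\<in>histories t. F h * prob (cylinder t h))"
    by (subst Bochner_Integration.integral_sum)
      (auto intro!: integrable_mult_right integrable_real_indicator simp: emeasure_eq_measure)
  finally show ?thesis .
qed

text \<open>Chain rule with independence within the round. A history of probability 0 provides no
  conditional law, but then both sides vanish.\<close>

lemma prob_next_round:
  "prob (cylinder t h \<inter> {\<omega> \<in> space M. \<forall>i. V t i \<omega> = c i})
    = prob (cylinder t h) * (\<Prod>i\<in>UNIV. visit_prob \<sigma> h t i (c i))"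
proof (cases "prob (cylinder t h) > 0")
  case True
  then have "\<P>(\<omega> in M. \<forall>i. V t i \<omega> = c i \<bar> \<forall>s<t. \<forall>k. V s k \<omega> = h s k) =
      (\<Prod>i\<in>UNIV. visit_prob \<sigma> h t i (c i))"
    by (simp add: visit_indep visit_law)
  moreover have "{\<omega> \<in> space M. (\<forall>i. V t i \<omega> = c i) \<and> (\<forall>s<t. \<forall>k. V s k \<omega> = h s k)}
      = cylinder t h \<inter> {\<omega> \<in> space M. \<forall>i. V t i \<omega> = c i}" by auto
  ultimately show ?thesis using True by (simp add: cond_prob_def field_simps)
next
  case False
  then have "prob (cylinder t h) = 0" using zero_less_measure_iff by blast
  moreover have "prob (cylinder t h \<inter> {\<omega> \<in> space M. \<forall>i. V t i \<omega> = c i}) \<le> prob (cylinder t h)"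
    by (intro finite_measure_mono) auto
  ultimately show ?thesis by (simp add: measure_le_0_iff)
qed

text \<open>The tower property in finite form: the cylinders, refined by the choices of round
  \<open>t\<close>, partition the space.\<close>

lemma expectation_next_round:
  assumes "determined_before (Suc t) F"
  shows "expectation (\<lambda>\<omega>. F (play \<omega>)) =
    (\<Sum>h\<in>histories t. round_mean \<sigma> h t (\<lambda>c. F (h(t := c))) * prob (cylinder t h))"
proof -
  let ?C = "\<lambda>c. {\<omega> \<in> space M. \<forall>i. V t i \<omega> = c i}"
  have eq: "(\<Sum>c\<in>UNIV. \<Sum>h\<in>histories t. F (h(t := c)) * indicator (cylinder t h \<inter> ?C c) \<omega>) = F (play \<omega>)"
    if "\<omega> \<in> space M" for \<omega>
  proof -
    have det: "determined_before t (\<lambda>h. F (h(t := c)))" for c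
      using assms unfolding determined_before_def by (simp add: less_Suc_eq)
    have "(\<Sum>c\<in>UNIV. \<Sum>h\<in>histories t. F (h(t := c)) * indicator (cylinder t h \<inter> ?C c) \<omega>)
      = (\<Sum>c\<in>UNIV. (\<Sum>h\<in>histories t. F (h(t := c)) * indicator (cylinder t h) \<omega>) * indicator (?C c) \<omega>)"
      by (simp add: sum_distrib_right indicator_inter_arith mult.assoc)
    also have "\<dots> = (\<Sum>c\<in>UNIV. F ((play \<omega>)(t := c)) * indicator (?C c) \<omega>)"
      by (simp only: sum_cylinder_indicator[OF det that])
    also have "\<dots> = (\<Sum>c\<in>UNIV. if c = play \<omega> t then F ((play \<omega>)(t := c)) else 0)"
      using that by (intro sum.cong) (auto simp: indicator_def fun_eq_iff)
    also have "\<dots> = F ((play \<omega>)(t := play \<omega> t))" by simp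
    also have "(play \<omega>)(t := play \<omega> t) = play \<omega>" by (intro ext) simp
    finally show ?thesis .
  qed
  have "expectation (\<lambda>\<omega>. F (play \<omega>)) =
     expectation (\<lambda>\<omega>. \<Sum>c\<in>UNIV. \<Sum>h\<in>histories t. F (h(t := c)) * indicator (cylinder t h \<inter> ?C c) \<omega>)"
    using eq by (intro Bochner_Integration.integral_cong) auto
  also have "\<dots> = (\<Sum>c\<in>UNIV. \<Sum>h\<in>histories t. F (h(t := c)) * prob (cylinder t h \<inter> ?C c))"
  proof -
    have int: "integrable M (\<lambda>\<omega>. F (h(t := c)) * indicator (cylinder t h \<inter> ?C c) \<omega>)" for h c
      by (intro integrable_mult_right integrable_real_indicator) (auto simp: emeasure_eq_measure)
    have val: "expectation (\<lambda>\<omega>. F (h(t := c)) * indicator (cylinder t h \<inter> ?C c) \<omega>)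
        = F (h(t := c)) * prob (cylinder t h \<inter> ?C c)" for h c
    proof -
      have "cylinder t h \<inter> ?C c \<inter> space M = cylinder t h \<inter> ?C c" by blast
      then show ?thesis by simp
    qed
    show ?thesis
      by (subst Bochner_Integration.integral_sum, intro Bochner_Integration.integrable_sum int)
        (intro sum.cong refl, subst Bochner_Integration.integral_sum, rule int, simp only: val)
  qed
  also have "\<dots> = (\<Sum>h\<in>histories t. \<Sum>c\<in>UNIV. F (h(t := c)) * prob (cylinder t h \<inter> ?C c))"
    by (rule sum.swap)
  also have "\<dots> = (\<Sum>h\<in>histories t. round_mean \<sigma> h t (\<lambda>c. F (h(t := c))) * prob (cylinder t h))"
    unfolding prob_next_round round_mean_def sum_distrib_right by (intro sum.cong refl) simp
  finally show ?thesis .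
qed

text \<open>Carries a drift inequality, valid for every past, over to expectations.\<close>

lemma expectation_next_round_le:
  assumes F: "determined_before (Suc t) F" and G: "determined_before t G"
    and le: "\<And>h. round_mean \<sigma> h t (\<lambda>c. F (h(t := c))) \<le> G h"
  shows "expectation (\<lambda>\<omega>. F (play \<omega>)) \<le> expectation (\<lambda>\<omega>. G (play \<omega>))"
  unfolding expectation_next_round[OF F] expectation_history[OF G]
  by (intro sum_mono mult_right_mono le measure_nonneg)

subsection \<open>Decay of the expectations\<close>

text \<open>Iterating the drift gives geometric decay with one rate for all stag hunters. The factor
  2 is a reserve: half of the exponent later pays for the threshold \<open>c * Suc t\<close> on the
  total weight.\<close>

lemma expectation_exp_total_weight:
  assumes "CARD('p) \<ge> 2"
  shows "\<exists>c>0. \<forall>i j t. \<sigma> i = Stag \<and> \<sigma> j = Stag \<and> j \<noteq> i \<longrightarrow>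
    expectation (\<lambda>\<omega>. exp (- total_weight \<sigma> (play \<omega>) t i)) \<le> exp (- (2 * c * t))"
proof -
  define q :: real where "q = 1 - (1 - exp (- 1)) / (1 + CARD('p))"
  have n: "0 < 1 + real (CARD('p))" by (simp add: add_pos_nonneg)
  have "(0::real) < 1 - exp (- 1)" by simp
  moreover have "1 - exp (- 1) < 1 + real (CARD('p))"
    using exp_gt_zero[of "- 1 :: real"] of_nat_0_le_iff[of "CARD('p)", where 'a=real] by linarith
  ultimately have "0 < (1 - exp (- 1)) / (1 + real (CARD('p)))" "(1 - exp (- 1)) / (1 + real (CARD('p))) < 1"
    using n by (simp_all only: divide_pos_pos divide_less_eq_1_pos)
  then have q: "0 < q" "q < 1" by (simp_all add: q_def)
  have "expectation (\<lambda>\<omega>. exp (- total_weight \<sigma> (play \<omega>) t i)) \<le> q ^ t"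
    if ij: "\<sigma> i = Stag" "\<sigma> j = Stag" "j \<noteq> i" for i j t
  proof (induction t)
    case 0
    have "expectation (\<lambda>\<omega>. exp (- total_weight \<sigma> (play \<omega>) 0 i)) \<le> 1"
    proof (rule integral_le_const)
      show "integrable M (\<lambda>\<omega>. exp (- total_weight \<sigma> (play \<omega>) 0 i))"
        by (rule integrable_history[of 0], rule determined_beforeI[of \<sigma>]) (simp add: total_weight_def)
      show "AE \<omega> in M. exp (- total_weight \<sigma> (play \<omega>) 0 i) \<le> 1"
        using total_weight_ge_1[OF ij(3), of \<sigma> _ 0] by (intro AE_I2) (simp add: order.trans[OF zero_le_one])
    qed
    then show ?case by simp
  next
    case (Suc t)
    have "expectation (\<lambda>\<omega>. exp (- total_weight \<sigma> (play \<omega>) (Suc t) i))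
        \<le> expectation (\<lambda>\<omega>. q * exp (- total_weight \<sigma> (play \<omega>) t i))"
    proof (rule expectation_next_round_le[where F = "\<lambda>v. exp (- total_weight \<sigma> v (Suc t) i)"
          and G = "\<lambda>v. q * exp (- total_weight \<sigma> v t i)"])
      show "round_mean \<sigma> h t (\<lambda>c. exp (- total_weight \<sigma> (h(t := c)) (Suc t) i)) \<le> q * exp (- total_weight \<sigma> h t i)" for h
        unfolding q_def by (rule stag_total_weight_drift[where \<sigma>=\<sigma>, OF assms ij])
    qed (rule determined_beforeI[of \<sigma>]; simp add: total_weight_def)+
    also have "\<dots> = q * expectation (\<lambda>\<omega>. exp (- total_weight \<sigma> (play \<omega>) t i))" by simp
    also have "\<dots> \<le> q * q ^ t" using Suc q by (intro mult_left_mono) auto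
    finally show ?case by simp
  qed
  moreover have "q ^ t = exp (- (2 * (- ln q / 2) * real t))" for t
    using q by (simp add: exp_of_nat2_mult)
  moreover have "0 < - ln q / 2" using q by simp
  ultimately show ?thesis by metis
qed

text \<open>The bound \<open>r \<le> 1\<close> is recorded because
  \<open>expectation_rabbit_inv_div\<close> compares the exponents \<open>- 2\<close> and
  \<open>- 1 - r\<close>.\<close>

lemma expectation_rabbit_inv:
  assumes card: "CARD('p) \<ge> 2" and ij: "\<sigma> i = Rabbit" "\<sigma> j = Rabbit" "j \<noteq> i"
  shows "\<exists>r K. 0 < r \<and> r \<le> 1 \<and> 0 \<le> K \<and>
    (\<forall>t. expectation (\<lambda>\<omega>. rabbit_inv \<sigma> (play \<omega>) t i) \<le> K * real (Suc t) powr (- r))"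
\<comment> \<open>This drift has no source term, hence \<open>C = 0\<close>; \<open>d = 1\<close> is
  an arbitrary positive value.\<close>
proof (rule decay_of_recursion[where C = 0 and d = 1, OF return_rate_bounds(1)[where 'p='p] return_rate_bounds(2)])
  fix t
  let ?e = "return_rate TYPE('p) / Suc t"
  have "expectation (\<lambda>\<omega>. rabbit_inv \<sigma> (play \<omega>) (Suc t) i) \<le> expectation (\<lambda>\<omega>. (1 - ?e) * rabbit_inv \<sigma> (play \<omega>) t i)"
  proof (rule expectation_next_round_le[where F = "\<lambda>v. rabbit_inv \<sigma> v (Suc t) i"
        and G = "\<lambda>v. (1 - ?e) * rabbit_inv \<sigma> v t i"])
    show "round_mean \<sigma> h t (\<lambda>c. rabbit_inv \<sigma> (h(t := c)) (Suc t) i) \<le> (1 - ?e) * rabbit_inv \<sigma> h t i" for h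
      by (rule rabbit_inv_drift[where \<sigma>=\<sigma>, OF card ij])
  qed (rule determined_beforeI[of \<sigma>]; simp add: rabbit_inv_def type_weight_def)+
  then show "expectation (\<lambda>\<omega>. rabbit_inv \<sigma> (play \<omega>) (Suc t) i)
      \<le> (1 - ?e) * expectation (\<lambda>\<omega>. rabbit_inv \<sigma> (play \<omega>) t i) + 0 * real (Suc t) powr (- 1 - 1)" by simp
qed auto

lemma integrable_rabbit_inv: "integrable M (\<lambda>\<omega>. rabbit_inv \<sigma> (play \<omega>) t i)"
  by (rule integrable_history[of t], rule determined_beforeI[of \<sigma>]) (simp add: rabbit_inv_def type_weight_def)

lemma integrable_exp_total_weight: "integrable M (\<lambda>\<omega>. exp (- total_weight \<sigma> (play \<omega>) t i))"
  by (rule integrable_history[of t], rule determined_beforeI[of \<sigma>]) (simp add: total_weight_def)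

lemma integrable_stag_ratio:
  "integrable M (\<lambda>\<omega>. type_weight \<sigma> (play \<omega>) t i Stag * rabbit_inv \<sigma> (play \<omega>) t i)"
  by (rule integrable_history[of t], rule determined_beforeI[of \<sigma>]) (simp add: rabbit_inv_def type_weight_def)

lemma integrable_rabbit_inv_div: "integrable M (\<lambda>\<omega>. rabbit_inv \<sigma> (play \<omega>) t i / total_weight \<sigma> (play \<omega>) t l)"
  by (rule integrable_history[of t], rule determined_beforeI[of \<sigma>])
    (simp add: rabbit_inv_def type_weight_def total_weight_def)

text \<open>The total weight of \<open>l\<close> exceeds a linear threshold outside an event of
  exponentially small probability. Above the threshold the division gains \<open>1 / Suc t\<close>
  on top of the decay of \<open>rabbit_inv\<close>; below it the quotient is at most 4.\<close>

lemma expectation_rabbit_inv_div: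
  assumes card: "CARD('p) \<ge> 2" and ij: "\<sigma> i = Rabbit" "\<sigma> j = Rabbit" "j \<noteq> i"
    and stags: "\<And>l. \<sigma> l = Stag \<Longrightarrow> \<exists>m. \<sigma> m = Stag \<and> m \<noteq> l"
  shows "\<exists>r C. 0 < r \<and> 0 \<le> C \<and> (\<forall>t l. \<sigma> l = Stag \<longrightarrow>
    expectation (\<lambda>\<omega>. rabbit_inv \<sigma> (play \<omega>) t i / total_weight \<sigma> (play \<omega>) t l) \<le> C * real (Suc t) powr (- 1 - r))"
proof -
  obtain r K where r: "0 < r" "r \<le> 1" "0 \<le> K"
    and inv: "\<And>t. expectation (\<lambda>\<omega>. rabbit_inv \<sigma> (play \<omega>) t i) \<le> K * real (Suc t) powr (- r)"
    using expectation_rabbit_inv[OF card ij] by blast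
  obtain c where c: "0 < c" and exp: "\<And>l m t. \<sigma> l = Stag \<Longrightarrow> \<sigma> m = Stag \<Longrightarrow> m \<noteq> l \<Longrightarrow>
    expectation (\<lambda>\<omega>. exp (- total_weight \<sigma> (play \<omega>) t l)) \<le> exp (- (2 * c * t))"
    using expectation_exp_total_weight[OF card] by blast
  \<comment> \<open>The first term accounts for large total weights, the second,
    \<open>4 * exp (2 * c)\<close> times \<open>2 / c\<^sup>2\<close>, for small ones.\<close>
  define C where "C = K / c + 8 * exp (2 * c) / c\<^sup>2"
  have "expectation (\<lambda>\<omega>. rabbit_inv \<sigma> (play \<omega>) t i / total_weight \<sigma> (play \<omega>) t l) \<le> C * real (Suc t) powr (- 1 - r)"
    if l: "\<sigma> l = Stag" for t l
  proof -
    obtain m where m: "\<sigma> m = Stag" "m \<noteq> l" using stags[OF l] by blast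
    define s where "s = real (Suc t)"
    have s: "1 \<le> s" by (simp add: s_def)
    let ?g = "\<lambda>\<omega>. rabbit_inv \<sigma> (play \<omega>) t i"
    let ?W = "\<lambda>\<omega>. total_weight \<sigma> (play \<omega>) t l"
    \<comment> \<open>As in a Chernoff bound, the indicator of total weights below
      \<open>c * s\<close> is replaced by the exponential of the deficit.\<close>
    have "?g \<omega> / ?W \<omega> \<le> 1 / (c * s) * ?g \<omega> + 4 * exp (c * s) * exp (- ?W \<omega>)" for \<omega>
    proof (cases "c * s \<le> ?W \<omega>")
      case True
      have "?g \<omega> / ?W \<omega> \<le> ?g \<omega> / (c * s)"
        using rabbit_inv_bounds[where \<sigma>=\<sigma>, OF ij(2,3)] c s True by (intro frac_le) auto
      then show ?thesis by (simp add: add_increasing2)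
    next
      case False
      have "?g \<omega> / ?W \<omega> \<le> 4 / 1"
        using rabbit_inv_bounds[where \<sigma>=\<sigma>, OF ij(2,3)] total_weight_ge_1[OF m(2)] by (intro frac_le) auto
      also have "\<dots> \<le> 4 * exp (c * s - ?W \<omega>)" using False by simp
      also have "exp (c * s - ?W \<omega>) = exp (c * s) * exp (- ?W \<omega>)" by (simp flip: exp_add)
      finally show ?thesis using rabbit_inv_bounds(1)[where \<sigma>=\<sigma>, OF ij(2,3)] c s
        by (simp add: add_increasing)
    qed
    then have "expectation (\<lambda>\<omega>. ?g \<omega> / ?W \<omega>)
        \<le> expectation (\<lambda>\<omega>. 1 / (c * s) * ?g \<omega> + 4 * exp (c * s) * exp (- ?W \<omega>))"
      by (intro integral_mono Bochner_Integration.integrable_add integrable_mult_right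
          integrable_rabbit_inv integrable_exp_total_weight integrable_rabbit_inv_div)
    also have "\<dots> = 1 / (c * s) * expectation ?g + 4 * exp (c * s) * expectation (\<lambda>\<omega>. exp (- ?W \<omega>))"
      by (subst Bochner_Integration.integral_add) (auto intro!: integrable_mult_right
          integrable_rabbit_inv integrable_exp_total_weight simp del: times_divide_eq_left)
    also have "\<dots> \<le> 1 / (c * s) * (K * s powr (- r)) + 4 * exp (c * s) * exp (- (2 * c * t))"
      using c s inv[of t] exp[OF l m, of t] by (intro add_mono mult_left_mono) (auto simp: s_def)
    also have "1 / (c * s) * (K * s powr (- r)) = K / c * s powr (- 1 - r)"
      using s by (simp add: powr_diff powr_minus field_simps)
    \<comment> \<open>\<open>t = s - 1\<close> costs the constant factor
      \<open>exp (2 * c)\<close>.\<close>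
    also have "4 * exp (c * s) * exp (- (2 * c * t)) = 4 * exp (2 * c) * exp (- (c * s))"
    proof -
      have "c * s + - (2 * c * t) = 2 * c + - (c * s)" by (simp add: s_def algebra_simps)
      then show ?thesis by (simp only: mult.assoc exp_add [symmetric])
    qed
    also have "exp (- (c * s)) \<le> 2 / c\<^sup>2 * s powr (- 1 - r)"
    proof -
      have "(c * s)\<^sup>2 / 2 \<le> exp (c * s)"
        using exp_lower_Taylor_quadratic[of "c * s"] mult_pos_pos[of c s] c s by linarith
      then have "inverse (exp (c * s)) \<le> inverse ((c * s)\<^sup>2 / 2)" using c s by (intro le_imp_inverse_le) auto
      also have "\<dots> = 2 / c\<^sup>2 * s powr (- 2)" using s by (simp add: powr_minus powr_numeral field_simps)
      also have "\<dots> \<le> 2 / c\<^sup>2 * s powr (- 1 - r)" using s r by (intro mult_left_mono powr_mono) auto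
      finally show ?thesis by (simp add: exp_minus)
    qed
    finally show ?thesis by (simp add: C_def s_def algebra_simps)
  qed
  moreover have "0 \<le> C" using r c by (simp add: C_def)
  ultimately show ?thesis using r by blast
qed

text \<open>The visits of stag hunters enter the drift as a source whose mean is smaller than
  \<open>1 / Suc t\<close> by a power, so the contraction prevails.\<close>

lemma expectation_stag_ratio:
  assumes card: "CARD('p) \<ge> 2" and ij: "\<sigma> i = Rabbit" "\<sigma> j = Rabbit" "j \<noteq> i"
    and stags: "\<And>l. \<sigma> l = Stag \<Longrightarrow> \<exists>m. \<sigma> m = Stag \<and> m \<noteq> l"
  shows "\<exists>r K. 0 < r \<and> 0 \<le> K \<and> (\<forall>t. expectation (\<lambda>\<omega>. type_weight \<sigma> (play \<omega>) t i Stag * rabbit_inv \<sigma> (play \<omega>) t i)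
    \<le> K * real (Suc t) powr (- r))"
proof -
  obtain d C where d: "0 < d" "0 \<le> C" and div: "\<And>t l. \<sigma> l = Stag \<Longrightarrow>
    expectation (\<lambda>\<omega>. rabbit_inv \<sigma> (play \<omega>) t i / total_weight \<sigma> (play \<omega>) t l) \<le> C * real (Suc t) powr (- 1 - d)"
    using expectation_rabbit_inv_div[OF card ij stags] by blast
  let ?n = "real (card {l. \<sigma> l = Stag})"
  let ?a = "\<lambda>t. expectation (\<lambda>\<omega>. type_weight \<sigma> (play \<omega>) t i Stag * rabbit_inv \<sigma> (play \<omega>) t i)"
  have "\<exists>r K. 0 < r \<and> r \<le> 1 \<and> 0 \<le> K \<and> (\<forall>t. ?a t \<le> K * real (Suc t) powr (- r))"
  \<comment> \<open>Each of the \<open>?n\<close> stag hunters contributes one source term.\<close>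
  proof (rule decay_of_recursion[where C = "3/4 * (?n * C)" and d = d, OF return_rate_bounds(1)[where 'p='p] return_rate_bounds(2)])
    fix t
    let ?e = "return_rate TYPE('p) / Suc t"
    let ?G = "\<lambda>v. (1 - ?e) * (type_weight \<sigma> v t i Stag * rabbit_inv \<sigma> v t i)
          + 3/4 * (\<Sum>l | \<sigma> l = Stag. rabbit_inv \<sigma> v t i / total_weight \<sigma> v t l)"
    have "?a (Suc t) \<le> expectation (\<lambda>\<omega>. ?G (play \<omega>))"
    proof (rule expectation_next_round_le[where G = ?G
          and F = "\<lambda>v. type_weight \<sigma> v (Suc t) i Stag * rabbit_inv \<sigma> v (Suc t) i"])
      show "round_mean \<sigma> h t (\<lambda>c. type_weight \<sigma> (h(t := c)) (Suc t) i Stag * rabbit_inv \<sigma> (h(t := c)) (Suc t) i) \<le> ?G h" for h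
        by (rule stag_ratio_drift[where \<sigma>=\<sigma>, OF card ij])
    qed (rule determined_beforeI[of \<sigma>]; simp add: rabbit_inv_def type_weight_def total_weight_def)+
    also have "\<dots> = (1 - ?e) * ?a t + 3/4 * (\<Sum>l | \<sigma> l = Stag.
        expectation (\<lambda>\<omega>. rabbit_inv \<sigma> (play \<omega>) t i / total_weight \<sigma> (play \<omega>) t l))"
      by (simp only: Bochner_Integration.integral_add Bochner_Integration.integral_sum integral_mult_right_zero
          integrable_stag_ratio integrable_rabbit_inv_div Bochner_Integration.integrable_sum integrable_mult_right)
    also have "\<dots> \<le> (1 - ?e) * ?a t + 3/4 * (\<Sum>l | \<sigma> l = Stag. C * real (Suc t) powr (- 1 - d))"
      using div by (intro add_left_mono mult_left_mono sum_mono) auto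
    finally show "?a (Suc t) \<le> (1 - ?e) * ?a t + 3/4 * (?n * C) * real (Suc t) powr (- 1 - d)" by simp
  qed (use d in auto)
  then show ?thesis by blast
qed

section \<open>Almost sure convergence\<close>

lemma AE_no_self_visit:
  assumes card: "CARD('p) \<ge> 2"
  shows "AE \<omega> in M. V t i \<omega> \<noteq> i"
proof -
  have "expectation (\<lambda>\<omega>. of_bool (play \<omega> t i = i)) =
      (\<Sum>h\<in>histories t. round_mean \<sigma> h t (\<lambda>c. of_bool ((h(t := c)) t i = i)) * prob (cylinder t h))"
    by (rule expectation_next_round) (simp add: determined_before_def)
  also have "\<dots> = 0"
  proof (intro sum.neutral ballI)
    fix h
    have "visit_prob \<sigma> h t i i = 0" by (simp add: visit_prob_total)
    then show "round_mean \<sigma> h t (\<lambda>c. of_bool ((h(t := c)) t i = i)) * prob (cylinder t h) = 0"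
      using round_mean_single[OF card, of \<sigma> h t "\<lambda>a. of_bool (a = i)" i] by simp
  qed
  finally have "expectation (\<lambda>\<omega>. of_bool (play \<omega> t i = i) :: real) = 0" .
  moreover have "integrable M (\<lambda>\<omega>. of_bool (play \<omega> t i = i) :: real)"
    by (rule integrable_history[of "Suc t"]) (simp add: determined_before_def)
  ultimately have "AE \<omega> in M. of_bool (play \<omega> t i = i) = (0::real)"
    by (subst (asm) integral_nonneg_eq_0_iff_AE) auto
  then show ?thesis by simp
qed

text \<open>For a stag hunter the mean of the exponential is summable over all times. For a rabbit
  hunter the decay is only polynomial and need not be summable, but it becomes geometric along the
  times \<open>2 ^ k\<close>.\<close>

lemma AE_visit_prob_tendsto_0:
  assumes stags: "card {i. \<sigma> i = Stag} \<noteq> 1" and rabbits: "card {i. \<sigma> i = Rabbit} \<noteq> 1"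
    and ij: "\<sigma> i \<noteq> \<sigma> j"
  shows "AE \<omega> in M. (\<lambda>t. visit_prob \<sigma> (play \<omega>) t i j) \<longlonglongrightarrow> 0"
proof -
  have "card {i, j} \<le> CARD('p)" by (intro card_mono) auto
  with ij have card: "CARD('p) \<ge> 2" by (cases "i = j") auto
  \<comment> \<open>A type that occurs occurs at least twice, so every player has a companion of the
    same type.\<close>
  have other: "\<exists>m. \<sigma> m = s \<and> m \<noteq> l" if "\<sigma> l = s" "card {i. \<sigma> i = s} \<noteq> 1" for l s
  proof (rule ccontr)
    assume "\<not> ?thesis"
    with that(1) have "{i. \<sigma> i = s} = {l}" by blast
    with that(2) show False by simp
  qed
  show ?thesis
  proof (cases "\<sigma> i")
    case Stag
    with ij have j: "\<sigma> j = Rabbit" by (cases "\<sigma> j") auto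
    obtain m where m: "\<sigma> m = Stag" "m \<noteq> i" using other[OF Stag stags] by blast
    obtain c where c: "0 < c" "\<And>t. expectation (\<lambda>\<omega>. exp (- total_weight \<sigma> (play \<omega>) t i)) \<le> exp (- (2 * c * t))"
      using expectation_exp_total_weight[OF card] Stag m by blast
    have geometric: "exp (- (2 * c * real t)) = exp (- (2 * c)) ^ t" for t
      using exp_of_nat2_mult[of "- (2 * c)" t] by (simp only: mult_minus_left)
    have "summable (\<lambda>t. exp (- (2 * c * real t)))"
      unfolding geometric using c(1) by (intro summable_geometric) simp
    from AE_tendsto_0_of_summable_expectation[OF integrable_exp_total_weight _ c(2) this]
    have "AE \<omega> in M. (\<lambda>t. exp (- total_weight \<sigma> (play \<omega>) t i)) \<longlonglongrightarrow> 0" by simp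
    then show ?thesis by eventually_elim (rule visit_prob_Stag_tendsto_0[where \<sigma>=\<sigma>, OF Stag j])
  next
    case Rabbit
    with ij have j: "\<sigma> j = Stag" by (cases "\<sigma> j") auto
    obtain l where l: "\<sigma> l = Rabbit" "l \<noteq> i" using other[OF Rabbit rabbits] by blast
    obtain r K where r: "0 < r" "0 \<le> K" and
      le: "\<And>t. expectation (\<lambda>\<omega>. type_weight \<sigma> (play \<omega>) t i Stag * rabbit_inv \<sigma> (play \<omega>) t i) \<le> K * real (Suc t) powr (- r)"
      using expectation_stag_ratio[OF card Rabbit l other[OF _ stags]] by blast
    have le2: "expectation (\<lambda>\<omega>. type_weight \<sigma> (play \<omega>) (2 ^ k) i Stag * rabbit_inv \<sigma> (play \<omega>) (2 ^ k) i)
        \<le> K * (2 powr (- r)) ^ k" for k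
    proof -
      have "real (Suc (2 ^ k)) powr (- r) \<le> (2 ^ k) powr (- r)" using r by (intro powr_mono2') auto
      also have "(2 ^ k) powr (- r) = (2 powr real k) powr (- r)" by (simp add: powr_realpow)
      also have "\<dots> = (2 powr (- r)) powr real k" by (simp only: powr_powr mult.commute)
      also have "\<dots> = (2 powr (- r)) ^ k" by (simp add: powr_realpow)
      finally show ?thesis using le[of "2 ^ k"] r by (meson mult_left_mono order.trans)
    qed
    have "2 powr (- r) < 1" using r by (simp add: powr_less_one)
    then have "summable (\<lambda>k. K * (2 powr (- r)) ^ k)" by (intro summable_mult summable_geometric) simp
    from AE_tendsto_0_of_summable_expectation[OF integrable_stag_ratio
        mult_nonneg_nonneg[OF type_weight_nonneg rabbit_inv_bounds(1)[where \<sigma>=\<sigma>, OF l]] le2 this]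
    have "AE \<omega> in M. (\<lambda>k. type_weight \<sigma> (play \<omega>) (2 ^ k) i Stag * rabbit_inv \<sigma> (play \<omega>) (2 ^ k) i) \<longlonglongrightarrow> 0" .
    moreover have "AE \<omega> in M. \<forall>t. V t i \<omega> \<noteq> i" by (simp add: AE_all_countable AE_no_self_visit[OF card])
    ultimately show ?thesis
      by eventually_elim (rule visit_prob_Rabbit_tendsto_0[where \<sigma>=\<sigma>, OF Rabbit l j], auto)
  qed
qed

end

theorem theorem6:
  fixes M :: "'a measure"
    and \<sigma> :: "'p::finite \<Rightarrow> strategy"
    and V :: "nat \<Rightarrow> 'p \<Rightarrow> 'a \<Rightarrow> 'p"
    and n :: nat
  assumes "stag_hunt_network M \<sigma> V"
    and "CARD('p) = 2 * n"
    and "card {i. \<sigma> i = Stag} \<noteq> 1"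
    and "card {i. \<sigma> i = Rabbit} \<noteq> 1"
  shows "AE \<omega> in M. \<forall>i j. i \<noteq> j \<and> \<sigma> i \<noteq> \<sigma> j \<longrightarrow>
           (\<lambda>t. visit_prob \<sigma> (\<lambda>s k. V s k \<omega>) t i j) \<longlonglongrightarrow> 0"
proof -
  interpret stag_hunt_network M \<sigma> V by fact
  show ?thesis
    \<comment> \<open>There are only finitely many pairs of players, so the exceptional null sets
      unite to a null set.\<close>
    unfolding AE_all_countable
    using AE_visit_prob_tendsto_0[OF assms(3,4)] by (intro allI AE_impI) simp
qed

end
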